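(* Let $M_1, \ldots, M_n$ be independent copies of a $d$ by $d$ positive semi-definite symmetric random matrix $M$ with mean $\mathbf{E} M = \Sigma$, where $\Sigma\neq 0$. Suppose that for some $\kappa \ge 1$, \[ \sqrt{\mathbf{E}(x^{\top} M x)^2} \le \kappa^2\, x^{\top}\Sigma x \quad \text{for all } x \in \mathbb{R}^d. \] Then, for any $t > \log 2$, with probability at least $1 - 2\exp(-t)$, it holds that \[ \sup_{v \in S^{d - 1}}\left(v^{\top}\Sigma v - \frac{1}{n}\sum_{i = 1}^nv^{\top}M_iv\right) \le 7\kappa^2\|\Sigma\|\sqrt{\frac{\mathbf{r}(\Sigma) + t}{n}}. \]
   Context: $\|\cdot\|$ denotes the operator norm of a matrix, $S^{d-1}$ is the unit sphere of $\mathbb{R}^d$, and $\log$ is the natural logarithm. For a nonzero positive semi-definite matrix $\Sigma$, the effective rank is $\mathbf{r}(\Sigma) = \operatorname{Tr}(\Sigma)/\|\Sigma\|$. *)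

theory Defs
  imports "HOL-Probability.Probability"
begin

definition psd_matrix :: "real ^ 'd ^ 'd \<Rightarrow> bool" where
  "psd_matrix A \<longleftrightarrow> transpose A = A \<and> (\<forall>x. 0 \<le> x \<bullet> (A *v x))"

definition op_norm :: "real ^ 'd ^ 'd \<Rightarrow> real" where
  "op_norm A = onorm (\<lambda>x. A *v x)"

definition effective_rank :: "real ^ 'd ^ 'd \<Rightarrow> real" where
  "effective_rank A = trace A / op_norm A"

end

theory Submission
  imports Defs
begin

text \<open>Write $q_A(x) = x^{\top} A x$, $N = \|\Sigma\|$, $T = \mathrm{Tr}\,\Sigma$ and
  $\varepsilon = \sqrt{(\mathbf{r}(\Sigma) + t)/n}$. The proof is a PAC-Bayesian one: the
  supremum over the sphere is controlled by averaging over the Gaussian vector $v + s\xi$, where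
  $\xi$ is standard normal and $s$ is fixed, instead of by a net or by chaining.

  Smoothing. For every measurable $h$, a single integral $\int e^{h(s\xi)}$ controls all the
  means $\mathbf{E} h(v + s\xi)$ at once: translating the Gaussian by $v/s$ and applying Jensen's
  inequality, $\int e^{h(s\xi)} \le e^t$ implies
  $\mathbf{E} h(v + s\xi) \le t + |v|^2/(2s^2)$ for all $v$ for which this mean exists (lemma
  \<open>gaussian_smoothing_bound\<close>). With $s^2 = N/(2T)$ and $|v| = 1$ the right-hand side is
  $t + \mathbf{r}(\Sigma)$; this is how the effective rank enters.

  The function $h$. Since $\mathbf{E} q_A(v + s\xi) = q_A(v) + s^2\,\mathrm{Tr}\,A$, the function
  $s^2\,\mathrm{Tr}\,A - q_A(x)$ averages to $-q_A(v)$, so no trace term survives the smoothing.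
  The price is that the exponent $\eta (s^2\,\mathrm{Tr}\,M - q_M(x))$ can be large when the trace
  of $M$ is. Replacing $M$ by the smaller matrix $\frac{S}{S + \mathrm{Tr}\,M} M$, whose trace is at
  most $S$, keeps the exponent at most $1$ as soon as $\eta s^2 S \le 1$. This is harmless in the
  direction considered: it only decreases the empirical forms, and it lowers $q_\Sigma(v)$
  by at most $\mathbf{E}\, q_M(v)\,\mathrm{Tr}\,M / S \le \kappa^4 q_\Sigma(v) T / S$.

  The exponential moment. From $e^z \le 1 + z + z^2$ for $z \le 1$ and the moment hypothesis
  (which gives $\mathbf{E}\, q_M(x)^2 \le \kappa^4 q_\Sigma(x)^2$ and, by the Cauchy-Schwarz
  inequality, $\mathbf{E} (\mathrm{Tr}\,M)^2 \le \kappa^4 T^2$), the cumulant generating function of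
  one summand is at most its mean plus $\eta^2 \kappa^4 (s^4 T^2 + q_\Sigma(x)^2)$ (lemma
  \<open>exponential_moment\<close>). Let $h$ be the sum of the exponents over the sample minus $n$ times
  this bound. Independence, Tonelli and Markov then give
  $\int e^{h(s\xi)} \le e^t$ with probability at least $1 - e^{-t}$ (lemma
  \<open>smoothed_exponential_bound\<close>). On that event the smoothing bound applies; the remaining
  Gaussian integral $\mathbf{E}\, q_\Sigma(v + s\xi)^2$ is estimated through fourth moments by
  $q_\Sigma(v)^2 + 6 s^2 q_\Sigma(v) T + 3 s^4 T^2$. For $\eta = \varepsilon/(2\kappa^2 N)$ and
  $S = \kappa^2 T/\varepsilon$ the smoothing bound contributes
  $\frac{9}{2} \kappa^2 N \varepsilon$ and the replacement of $M$ contributes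
  $\kappa^2 N \varepsilon$, together less than $7 \kappa^2 N \varepsilon$.\<close>

section \<open>Elementary inequalities\<close>

lemma exp_le_quadratic:
  fixes x :: real
  assumes "x \<le> 1"
  shows "exp x \<le> 1 + x + x\<^sup>2"
proof (cases "0 \<le> x")
  case True
  then show ?thesis using exp_bound[of x] assms by simp
next
  case False
  define y where "y = - x"
  have y: "0 < y" using False by (simp add: y_def)
  have "1 + y + y\<^sup>2 / 2 \<le> exp y"
    using exp_lower_Taylor_quadratic[of y] y by simp
  moreover have "1 \<le> (1 + y + y\<^sup>2 / 2) * (1 - y + y\<^sup>2)"
  proof -
    have "(1 + y + y\<^sup>2 / 2) * (1 - y + y\<^sup>2) = 1 + y\<^sup>2 / 2 + y ^ 3 / 2 + y ^ 4 / 2"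
      by (simp add: field_simps power2_eq_square power3_eq_cube power4_eq_xxxx)
    then show ?thesis using y by simp
  qed
  moreover have "0 \<le> 1 - y + y\<^sup>2"
    using zero_le_power2[of "y - 1/2"] by (simp add: power2_eq_square algebra_simps)
  ultimately have "1 \<le> exp y * (1 - y + y\<^sup>2)"
    by (meson mult_right_mono order_trans)
  then have "exp x \<le> 1 - y + y\<^sup>2"
    by (simp add: y_def exp_minus field_simps)
  then show ?thesis by (simp add: y_def)
qed

lemma nonneg_quadratic_discriminant:
  fixes a b c :: real
  assumes "\<And>s. 0 \<le> a + 2 * b * s + c * s\<^sup>2"
  shows "b\<^sup>2 \<le> a * c"
proof (cases "c = 0")
  case True
  have "b = 0"
  proof (rule ccontr)
    assume "b \<noteq> 0"
    then show False using assms[of "- (a + 1) / (2 * b)"] True by simp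
  qed
  then show ?thesis using True by simp
next
  case False
  have "0 < c"
  proof (rule ccontr)
    assume "\<not> 0 < c"
    then have c: "c < 0" using False by simp
    \<comment> \<open>the values of the quadratic at $s$ and $-s$ have a negative sum\<close>
    define s where "s = 1 + (1 + \<bar>a\<bar>) / - c"
    have "0 \<le> (a + 2 * b * s + c * s\<^sup>2) + (a + 2 * b * (- s) + c * (- s)\<^sup>2)"
      using assms[of s] assms[of "- s"] by linarith
    then have *: "- c * s\<^sup>2 \<le> a" by simp
    have "0 \<le> (1 + \<bar>a\<bar>) / - c" using c by (intro divide_nonneg_pos) auto
    then have "1 \<le> s" by (simp add: s_def)
    then have "s * 1 \<le> s * s" by (intro mult_left_mono) auto
    then have "- c * s \<le> - c * s\<^sup>2" using c by (simp add: power2_eq_square)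
    moreover have "- c * s = - c + (1 + \<bar>a\<bar>)" using c by (simp add: s_def field_simps)
    ultimately show False using * c by linarith
  qed
  then show ?thesis using assms[of "- b / c"]
    by (simp add: field_simps power2_eq_square)
qed

lemma integral_Cauchy_Schwarz:
  fixes f g :: "'a \<Rightarrow> real"
  assumes [measurable]: "f \<in> borel_measurable M" "g \<in> borel_measurable M"
    and f: "integrable M (\<lambda>x. (f x)\<^sup>2)" and g: "integrable M (\<lambda>x. (g x)\<^sup>2)"
  shows "integrable M (\<lambda>x. f x * g x)"
    and "(\<integral>x. f x * g x \<partial>M)\<^sup>2 \<le> (\<integral>x. (f x)\<^sup>2 \<partial>M) * (\<integral>x. (g x)\<^sup>2 \<partial>M)"
proof -
  show fg: "integrable M (\<lambda>x. f x * g x)"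
  proof (rule Bochner_Integration.integrable_bound)
    show "integrable M (\<lambda>x. (f x)\<^sup>2 + (g x)\<^sup>2)" using f g by simp
    have "\<bar>a * b\<bar> \<le> a\<^sup>2 + b\<^sup>2" for a b :: real
    proof -
      have "0 \<le> (\<bar>a\<bar> - \<bar>b\<bar>)\<^sup>2" by simp
      then have "2 * (\<bar>a\<bar> * \<bar>b\<bar>) \<le> a\<^sup>2 + b\<^sup>2" by (simp add: power2_diff)
      moreover have "0 \<le> \<bar>a\<bar> * \<bar>b\<bar>" by simp
      ultimately show ?thesis unfolding abs_mult by linarith
    qed
    then show "AE x in M. norm (f x * g x) \<le> norm ((f x)\<^sup>2 + (g x)\<^sup>2)" by simp
  qed simp
  show "(\<integral>x. f x * g x \<partial>M)\<^sup>2 \<le> (\<integral>x. (f x)\<^sup>2 \<partial>M) * (\<integral>x. (g x)\<^sup>2 \<partial>M)"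
  proof (rule nonneg_quadratic_discriminant)
    fix s
    have "0 \<le> (\<integral>x. (f x + s * g x)\<^sup>2 \<partial>M)" by simp
    also have "(\<lambda>x. (f x + s * g x)\<^sup>2) = (\<lambda>x. (f x)\<^sup>2 + 2 * s * (f x * g x) + s\<^sup>2 * (g x)\<^sup>2)"
      by (simp add: fun_eq_iff power2_eq_square algebra_simps)
    also have "(\<integral>x. (f x)\<^sup>2 + 2 * s * (f x * g x) + s\<^sup>2 * (g x)\<^sup>2 \<partial>M) =
       (\<integral>x. (f x)\<^sup>2 \<partial>M) + 2 * s * (\<integral>x. f x * g x \<partial>M) + s\<^sup>2 * (\<integral>x. (g x)\<^sup>2 \<partial>M)"
      using f g fg by simp
    finally show "0 \<le> (\<integral>x. (f x)\<^sup>2 \<partial>M) + 2 * (\<integral>x. f x * g x \<partial>M) * s + (\<integral>x. (g x)\<^sup>2 \<partial>M) * s\<^sup>2"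
      by (simp add: ac_simps)
  qed
qed

lemma (in prob_space) exp_expectation_le_nn_integral_exp:
  fixes Y :: "'a \<Rightarrow> real"
  assumes Y: "integrable M Y"
  shows "ennreal (exp (expectation Y)) \<le> (\<integral>\<^sup>+x. ennreal (exp (Y x)) \<partial>M)"
proof (cases "(\<integral>\<^sup>+x. ennreal (exp (Y x)) \<partial>M) = \<infinity>")
  case False
  have [measurable]: "Y \<in> borel_measurable M" using Y by auto
  have eY: "integrable M (\<lambda>x. exp (Y x))"
    using False by (intro integrableI_bounded) (auto simp: less_top)
  \<comment> \<open>integrate the tangent line of the exponential at the mean of \<open>Y\<close>\<close>
  have "exp (expectation Y) = (\<integral>x. exp (expectation Y) * (1 + (Y x - expectation Y)) \<partial>M)"
    using Y by (simp add: prob_space)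
  also have "\<dots> \<le> (\<integral>x. exp (Y x) \<partial>M)"
  proof (rule integral_mono)
    fix x
    show "exp (expectation Y) * (1 + (Y x - expectation Y)) \<le> exp (Y x)"
      using mult_left_mono[OF exp_ge_add_one_self[of "Y x - expectation Y"], of "exp (expectation Y)"]
      by (simp add: exp_add[symmetric])
  qed (use Y eY in auto)
  finally show ?thesis
    using eY by (simp add: nn_integral_eq_integral)
qed simp

section \<open>The standard Gaussian measure on a Euclidean space\<close>

text \<open>The law of a vector with independent standard normal coordinates, given by its density with
  respect to Lebesgue measure. Working with a density makes translations explicit.\<close>

definition std_gaussian :: "'a::euclidean_space measure" where
  "std_gaussian = density lborel (\<lambda>x. ennreal (\<Prod>b\<in>Basis. std_normal_density (x \<bullet> b)))"

lemma sets_std_gaussian [simp, measurable_cong]: "sets std_gaussian = sets borel"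
  by (simp add: std_gaussian_def)

lemma space_std_gaussian [simp]: "space std_gaussian = UNIV"
  by (simp add: std_gaussian_def)

lemma has_bochner_integral_lborel_prod:
  fixes f :: "'a::euclidean_space \<Rightarrow> real \<Rightarrow> real"
  assumes f: "\<And>b. b \<in> Basis \<Longrightarrow> integrable lborel (f b)"
  shows "has_bochner_integral lborel (\<lambda>x. \<Prod>b\<in>Basis. f b (x \<bullet> b)) (\<Prod>b\<in>Basis. \<integral>x. f b x \<partial>lborel)"
proof -
  interpret product_sigma_finite "\<lambda>b::'a. lborel :: real measure" ..
  have [measurable]: "\<And>b. b \<in> Basis \<Longrightarrow> f b \<in> borel_measurable borel"
    using f by (auto dest: borel_measurable_integrable)
  have m: "(\<lambda>w. \<Sum>b\<in>Basis. w b *\<^sub>R b) \<in> (\<Pi>\<^sub>M b\<in>(Basis::'a set). lborel) \<rightarrow>\<^sub>M borel"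
    by measurable
  have eq: "(\<Prod>b\<in>Basis. f b ((\<Sum>c\<in>Basis. w c *\<^sub>R c) \<bullet> b)) = (\<Prod>b\<in>Basis. f b (w b))" for w
    by (intro prod.cong) simp_all
  have "has_bochner_integral (\<Pi>\<^sub>M b\<in>(Basis::'a set). lborel)
      (\<lambda>w. \<Prod>b\<in>Basis. f b (w b)) (\<Prod>b\<in>Basis. \<integral>x. f b x \<partial>lborel)"
    using f by (simp add: has_bochner_integral_iff product_integrable_prod product_integral_prod)
  then show ?thesis
    by (subst lborel_eq, subst has_bochner_integral_iff,
        subst integrable_distr_eq[OF m], measurable, subst integral_distr[OF m], measurable)
      (simp add: eq has_bochner_integral_iff)
qed

text \<open>The moments of the one-dimensional standard normal distribution.\<close>

definition normal_moment :: "nat \<Rightarrow> real" where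
  "normal_moment k = (\<integral>x. std_normal_density x * x ^ k \<partial>lborel)"

lemma normal_moment_simps:
  "normal_moment 0 = 1" "normal_moment (Suc 0) = 0" "normal_moment 2 = 1"
  "normal_moment 3 = 0" "normal_moment 4 = 3"
proof -
  have ev: "normal_moment (2 * k) = fact (2 * k) / (2 ^ k * fact k)" for k
    unfolding normal_moment_def by (rule integral_std_normal_moment_even)
  have od: "normal_moment (2 * k + 1) = 0" for k
    unfolding normal_moment_def by (rule integral_std_normal_moment_odd)
  show "normal_moment 0 = 1" using ev[of 0] by simp
  show "normal_moment (Suc 0) = 0" using od[of 0] by simp
  show "normal_moment 2 = 1" using ev[of 1] by (simp add: fact_numeral)
  show "normal_moment 3 = 0" using od[of 1] by (simp add: eval_nat_numeral)
  show "normal_moment 4 = 3" using ev[of 2] by (simp add: fact_numeral)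
qed

lemma prod_list_inner_Basis:
  assumes "set l \<subseteq> Basis"
  shows "prod_list (map (\<lambda>b. x \<bullet> b) l) = (\<Prod>b\<in>Basis. (x \<bullet> b) ^ count_list l b)"
  using assms
proof (induction l)
  case (Cons a l)
  have "(\<Prod>b\<in>Basis. (x \<bullet> b) ^ count_list (a # l) b)
      = (\<Prod>b\<in>Basis. (if b = a then x \<bullet> b else 1) * (x \<bullet> b) ^ count_list l b)"
    by (intro prod.cong) auto
  also have "\<dots> = (x \<bullet> a) * (\<Prod>b\<in>Basis. (x \<bullet> b) ^ count_list l b)"
    using Cons.prems by (simp add: prod.distrib)
  finally show ?case using Cons by simp
qed simp

text \<open>A monomial in the coordinates is encoded by the list of its factors, so that the exponent of a
  coordinate is its multiplicity in the list.\<close>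

lemma std_gaussian_monomial:
  assumes "set l \<subseteq> Basis"
  shows "has_bochner_integral std_gaussian (\<lambda>x. prod_list (map (\<lambda>b. x \<bullet> b) l))
    (\<Prod>b\<in>set l. normal_moment (count_list l b))"
proof -
  have "has_bochner_integral lborel
      (\<lambda>x::'a. \<Prod>b\<in>Basis. std_normal_density (x \<bullet> b) * (x \<bullet> b) ^ count_list l b)
      (\<Prod>b\<in>Basis. normal_moment (count_list l b))"
    unfolding normal_moment_def
    by (rule has_bochner_integral_lborel_prod[where f="\<lambda>b x. std_normal_density x * x ^ count_list l b"])
      (rule integrable_std_normal_moment)
  also have "(\<Prod>b\<in>Basis. normal_moment (count_list l b)) = (\<Prod>b\<in>set l. normal_moment (count_list l b))"
    using assms by (intro prod.mono_neutral_right)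
      (auto simp: normal_moment_simps count_list_0_iff[THEN iffD2])
  finally show ?thesis
    unfolding std_gaussian_def
    by (intro has_bochner_integral_density)
      (auto simp: prod_list_inner_Basis[OF assms] prod.distrib prod_nonneg)
qed

lemma prob_space_std_gaussian: "prob_space (std_gaussian :: 'a::euclidean_space measure)"
proof -
  have *: "has_bochner_integral (std_gaussian :: 'a measure) (\<lambda>x. 1::real) 1"
    using std_gaussian_monomial[of "[] :: 'a list"] by simp
  have "emeasure (std_gaussian :: 'a measure) UNIV = (\<integral>\<^sup>+x. ennreal 1 \<partial>(std_gaussian :: 'a measure))"
    by simp
  also have "\<dots> = ennreal (\<integral>x. 1 \<partial>(std_gaussian :: 'a measure))"
    using * by (intro nn_integral_eq_integral) (simp_all only: has_bochner_integral_iff, simp)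
  also have "\<dots> = 1"
    using * by (simp only: has_bochner_integral_iff) simp
  finally show ?thesis
    by (intro prob_spaceI) simp
qed

text \<open>The last claim is Isserlis' formula for products of four coordinates.\<close>

lemma std_gaussian_moments:
  fixes a b c d :: "'a::euclidean_space"
  assumes [simp]: "a \<in> Basis" "b \<in> Basis" "c \<in> Basis" "d \<in> Basis"
  shows "has_bochner_integral std_gaussian (\<lambda>x. x \<bullet> a) 0"
    and "has_bochner_integral std_gaussian (\<lambda>x. (x \<bullet> a) * (x \<bullet> b)) (of_bool (a = b))"
    and "has_bochner_integral std_gaussian (\<lambda>x. (x \<bullet> a) * (x \<bullet> b) * (x \<bullet> c) * (x \<bullet> d))
      (of_bool (a = b \<and> c = d) + of_bool (a = c \<and> b = d) + of_bool (a = d \<and> b = c))"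
proof -
  note sq = numeral_2_eq_2[symmetric] numeral_3_eq_3[symmetric]
  show "has_bochner_integral std_gaussian (\<lambda>x. x \<bullet> a) 0"
    using std_gaussian_monomial[of "[a]"] by (simp add: normal_moment_simps)
  have "(\<Prod>m\<in>set [a, b]. normal_moment (count_list [a, b] m)) = of_bool (a = b)"
    by (cases "a = b") (simp_all add: normal_moment_simps sq)
  then show "has_bochner_integral std_gaussian (\<lambda>x. (x \<bullet> a) * (x \<bullet> b)) (of_bool (a = b))"
    using std_gaussian_monomial[of "[a, b]"] by simp
  have 4: "Suc (Suc (Suc (Suc 0))) = 4" by simp
  have ins: "insert x (insert y (insert x S)) = insert x (insert y S)" for x y :: 'a and S by auto
  have "(\<Prod>m\<in>set [a, b, c, d]. normal_moment (count_list [a, b, c, d] m)) =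
     of_bool (a = b \<and> c = d) + of_bool (a = c \<and> b = d) + of_bool (a = d \<and> b = c)"
    by (cases "a = b"; cases "a = c"; cases "a = d"; cases "b = c"; cases "b = d"; cases "c = d")
      (simp_all add: normal_moment_simps sq 4 ins)
  then show "has_bochner_integral std_gaussian (\<lambda>x. (x \<bullet> a) * (x \<bullet> b) * (x \<bullet> c) * (x \<bullet> d))
      (of_bool (a = b \<and> c = d) + of_bool (a = c \<and> b = d) + of_bool (a = d \<and> b = c))"
    using std_gaussian_monomial[of "[a, b, c, d]"] by (simp add: mult.assoc)
qed

text \<open>The translation formula: the exponential factor is the density of the law of $x - u$ with
  respect to the law of $x$.\<close>

lemma nn_integral_std_gaussian_shift:
  fixes F :: "'a::euclidean_space \<Rightarrow> ennreal"
  assumes [measurable]: "F \<in> borel_measurable borel"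
  shows "(\<integral>\<^sup>+x. F x \<partial>std_gaussian) =
    (\<integral>\<^sup>+x. F (u + x) * ennreal (exp (- (u \<bullet> x) - (u \<bullet> u) / 2)) \<partial>std_gaussian)"
proof -
  define p where "p x = (\<Prod>b\<in>Basis. std_normal_density (x \<bullet> b))" for x :: 'a
  have [measurable]: "p \<in> borel_measurable borel" unfolding p_def by measurable
  have p0: "0 \<le> p x" for x unfolding p_def by (simp add: prod_nonneg)
  have 1: "std_normal_density (s + y) = std_normal_density y * exp (- (s * y) - s * s / 2)" for s y
    by (simp add: std_normal_density_def exp_add[symmetric] power2_eq_square field_simps)
  have p: "p (u + x) = p x * exp (- (u \<bullet> x) - (u \<bullet> u) / 2)" for x
  proof -
    have "p (u + x) = p x * (\<Prod>b\<in>Basis. exp (- ((u \<bullet> b) * (x \<bullet> b)) - (u \<bullet> b) * (u \<bullet> b) / 2))"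
      by (simp add: p_def inner_add_left 1 prod.distrib)
    also have "(\<Prod>b\<in>Basis. exp (- ((u \<bullet> b) * (x \<bullet> b)) - (u \<bullet> b) * (u \<bullet> b) / 2))
       = exp (- (u \<bullet> x) - (u \<bullet> u) / 2)"
      by (simp add: exp_sum[symmetric] sum_subtractf sum_negf sum_divide_distrib[symmetric]
          euclidean_inner[symmetric])
    finally show ?thesis .
  qed
  have "(\<integral>\<^sup>+x. F x \<partial>std_gaussian) = (\<integral>\<^sup>+x. ennreal (p x) * F x \<partial>distr lborel borel ((+) u))"
    unfolding lborel_distr_plus by (simp add: std_gaussian_def nn_integral_density p_def[symmetric])
  also have "\<dots> = (\<integral>\<^sup>+x. ennreal (p (u + x)) * F (u + x) \<partial>lborel)"
    by (subst nn_integral_distr) auto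
  also have "\<dots> = (\<integral>\<^sup>+x. ennreal (p x) * (F (u + x) * ennreal (exp (- (u \<bullet> x) - (u \<bullet> u) / 2))) \<partial>lborel)"
    by (intro nn_integral_cong) (simp only: p ennreal_mult[OF p0 exp_ge_zero] mult.assoc mult.commute[of "F _"])
  also have "\<dots> = (\<integral>\<^sup>+x. F (u + x) * ennreal (exp (- (u \<bullet> x) - (u \<bullet> u) / 2)) \<partial>std_gaussian)"
    unfolding std_gaussian_def p_def[symmetric] by (subst nn_integral_density) auto
  finally show ?thesis .
qed

section \<open>Quadratic forms of positive semi-definite matrices\<close>

lemma bilinear_form_expand:
  fixes A :: "real ^ 'd ^ 'd"
  shows "x \<bullet> (A *v y) = (\<Sum>i\<in>UNIV. \<Sum>j\<in>UNIV. A $ i $ j * (x $ i * y $ j))"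
  by (simp add: inner_vec_def matrix_vector_mult_def sum_distrib_left ac_simps)

lemma bilinear_form_axis:
  fixes A :: "real ^ 'd ^ 'd"
  shows "axis i 1 \<bullet> (A *v axis j 1) = A $ i $ j"
  by (simp add: inner_axis' matrix_vector_mul_component matrix_vector_mult_basis column_def)

lemma trace_eq_sum_quadratic_form:
  fixes A :: "real ^ 'd ^ 'd"
  shows "trace A = (\<Sum>i\<in>UNIV. axis i 1 \<bullet> (A *v axis i 1))"
  by (simp add: trace_def bilinear_form_axis)

lemma psd_matrix_nonneg: "psd_matrix A \<Longrightarrow> 0 \<le> x \<bullet> (A *v x)"
  by (simp add: psd_matrix_def)

lemma psd_matrix_commute:
  fixes A :: "real ^ 'd ^ 'd"
  assumes "psd_matrix A"
  shows "x \<bullet> (A *v y) = y \<bullet> (A *v x)"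
proof -
  have "A *v x = x v* A"
    using assms by (metis psd_matrix_def transpose_matrix_vector)
  then show ?thesis by (metis dot_lmul_matrix inner_commute)
qed

lemma psd_matrix_Cauchy_Schwarz:
  fixes A :: "real ^ 'd ^ 'd"
  assumes "psd_matrix A"
  shows "(x \<bullet> (A *v y))\<^sup>2 \<le> (x \<bullet> (A *v x)) * (y \<bullet> (A *v y))"
proof (rule nonneg_quadratic_discriminant)
  fix s
  have "0 \<le> (x + s *\<^sub>R y) \<bullet> (A *v (x + s *\<^sub>R y))"
    using assms by (rule psd_matrix_nonneg)
  also have "\<dots> = x \<bullet> (A *v x) + 2 * (x \<bullet> (A *v y)) * s + y \<bullet> (A *v y) * s\<^sup>2"
    using psd_matrix_commute[OF assms, of y x]
    by (simp add: matrix_vector_right_distrib matrix_vector_mult_scaleR inner_add_left inner_add_right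
        power2_eq_square algebra_simps)
  finally show "0 \<le> x \<bullet> (A *v x) + 2 * (x \<bullet> (A *v y)) * s + y \<bullet> (A *v y) * s\<^sup>2" .
qed

lemma psd_matrix_entry_bound:
  fixes A :: "real ^ 'd ^ 'd"
  assumes "psd_matrix A"
  shows "(A $ i $ j)\<^sup>2 \<le> A $ i $ i * A $ j $ j"
  using psd_matrix_Cauchy_Schwarz[OF assms, of "axis i 1" "axis j 1"] by (simp add: bilinear_form_axis)

lemma psd_matrix_diag_nonneg:
  fixes A :: "real ^ 'd ^ 'd"
  assumes "psd_matrix A"
  shows "0 \<le> A $ i $ i"
  using psd_matrix_nonneg[OF assms, of "axis i 1"] by (simp add: bilinear_form_axis)

lemma psd_matrix_trace_nonneg:
  fixes A :: "real ^ 'd ^ 'd"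
  shows "psd_matrix A \<Longrightarrow> 0 \<le> trace A"
  by (simp add: trace_def sum_nonneg psd_matrix_diag_nonneg)

lemma psd_matrix_trace_pos:
  fixes A :: "real ^ 'd ^ 'd"
  assumes A: "psd_matrix A" and "A \<noteq> 0"
  shows "0 < trace A"
proof (rule ccontr)
  assume "\<not> 0 < trace A"
  then have "(\<Sum>i\<in>UNIV. A $ i $ i) = 0"
    using psd_matrix_trace_nonneg[OF A] by (simp add: trace_def)
  then have "A $ i $ i = 0" for i
    by (subst (asm) sum_nonneg_eq_0_iff) (auto simp: psd_matrix_diag_nonneg[OF A])
  then have "(A $ i $ j)\<^sup>2 \<le> 0" for i j
    using psd_matrix_entry_bound[OF A, of i j] by simp
  then have "A $ i $ j = 0" for i j by simp
  then have "A = 0" by (simp add: vec_eq_iff)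
  with \<open>A \<noteq> 0\<close> show False ..
qed

lemma quadratic_form_le_op_norm:
  fixes A :: "real ^ 'd ^ 'd"
  assumes "norm v = 1"
  shows "v \<bullet> (A *v v) \<le> op_norm A"
proof -
  have "v \<bullet> (A *v v) \<le> norm v * norm (A *v v)" by (rule norm_cauchy_schwarz)
  also have "norm (A *v v) \<le> onorm ((*v) A) * norm v"
    by (rule onorm) simp
  finally show ?thesis using assms by (simp add: op_norm_def)
qed

lemma op_norm_pos:
  fixes A :: "real ^ 'd ^ 'd"
  assumes "A \<noteq> 0"
  shows "0 < op_norm A"
proof -
  have "(*v) A \<noteq> (\<lambda>x. 0)"
    using assms by (metis matrix_eq matrix_vector_mult_0)
  then show ?thesis
    unfolding op_norm_def by (subst onorm_pos_lt) (auto simp: fun_eq_iff)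
qed

section \<open>Gaussian moments of quadratic forms\<close>

lemma std_gaussian_vec_moments:
  fixes i j k l :: "'d::finite"
  shows "has_bochner_integral std_gaussian (\<lambda>x::real ^ 'd. x $ i) 0"
    and "has_bochner_integral std_gaussian (\<lambda>x::real ^ 'd. x $ i * x $ j) (of_bool (i = j))"
    and "has_bochner_integral std_gaussian (\<lambda>x::real ^ 'd. x $ i * x $ j * (x $ k * x $ l))
      (of_bool (i = j \<and> k = l) + of_bool (i = k \<and> j = l) + of_bool (i = l \<and> j = k))"
  using std_gaussian_moments[of "axis i 1 :: real ^ 'd" "axis j 1" "axis k 1" "axis l 1"]
  by (simp_all add: inner_axis axis_eq_axis mult.assoc)

lemma std_gaussian_inner:
  fixes v :: "real ^ 'd"
  shows "has_bochner_integral std_gaussian (\<lambda>x. v \<bullet> x) 0"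
proof -
  have "has_bochner_integral std_gaussian (\<lambda>x. \<Sum>i\<in>UNIV. v $ i * x $ i) (\<Sum>i\<in>UNIV. v $ i * 0)"
    by (intro has_bochner_integral_sum has_bochner_integral_mult_right std_gaussian_vec_moments)
  then show ?thesis by (simp add: inner_vec_def)
qed

lemma std_gaussian_quadratic_form:
  fixes A :: "real ^ 'd ^ 'd"
  shows "has_bochner_integral std_gaussian (\<lambda>x. x \<bullet> (A *v x)) (trace A)"
proof -
  have "has_bochner_integral std_gaussian (\<lambda>x. \<Sum>i\<in>UNIV. \<Sum>j\<in>UNIV. A $ i $ j * (x $ i * x $ j))
     (\<Sum>i\<in>UNIV. \<Sum>j\<in>UNIV. A $ i $ j * of_bool (i = j))"
    by (intro has_bochner_integral_sum has_bochner_integral_mult_right std_gaussian_vec_moments)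
  then show ?thesis by (simp add: bilinear_form_expand trace_def)
qed

lemma std_gaussian_shifted_quadratic_form:
  fixes A :: "real ^ 'd ^ 'd"
  shows "has_bochner_integral std_gaussian (\<lambda>x. (v + s *\<^sub>R x) \<bullet> (A *v (v + s *\<^sub>R x)))
    (v \<bullet> (A *v v) + s\<^sup>2 * trace A)"
proof -
  interpret prob_space "std_gaussian :: (real ^ 'd) measure" by (rule prob_space_std_gaussian)
  have [simp]: "prob UNIV = 1" using prob_space by simp
  have 1: "has_bochner_integral std_gaussian (\<lambda>x::real ^ 'd. v \<bullet> (A *v v)) (v \<bullet> (A *v v))"
    by (simp add: has_bochner_integral_iff prob_space)
  have "has_bochner_integral std_gaussian
      (\<lambda>x. v \<bullet> (A *v v) + s * ((transpose A *v v + A *v v) \<bullet> x) + s\<^sup>2 * (x \<bullet> (A *v x)))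
      (v \<bullet> (A *v v) + s * 0 + s\<^sup>2 * trace A)"
    by (intro has_bochner_integral_add has_bochner_integral_mult_right 1 std_gaussian_inner
        std_gaussian_quadratic_form)
  also have "(\<lambda>x. v \<bullet> (A *v v) + s * ((transpose A *v v + A *v v) \<bullet> x) + s\<^sup>2 * (x \<bullet> (A *v x))) =
     (\<lambda>x. (v + s *\<^sub>R x) \<bullet> (A *v (v + s *\<^sub>R x)))"
    by (simp add: fun_eq_iff matrix_vector_right_distrib matrix_vector_mult_scaleR inner_add_left
        inner_add_right power2_eq_square algebra_simps dot_lmul_matrix inner_commute[of "A *v v"])
  finally show ?thesis by simp
qed

text \<open>By Isserlis' formula the mean is $(\mathrm{Tr}\,A)^2 + 2 \sum_{i,j} A_{ij}^2$, and
  $A_{ij}^2 \le A_{ii} A_{jj}$.\<close>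

lemma std_gaussian_quadratic_form_squared:
  fixes A :: "real ^ 'd ^ 'd"
  assumes A: "psd_matrix A"
  shows "integrable std_gaussian (\<lambda>x. (x \<bullet> (A *v x))\<^sup>2)"
    and "(\<integral>x. (x \<bullet> (A *v x))\<^sup>2 \<partial>std_gaussian) \<le> 3 * (trace A)\<^sup>2"
proof -
  have sym: "A $ i $ j = A $ j $ i" for i j
    using psd_matrix_commute[OF A, of "axis i 1" "axis j 1"] by (simp add: bilinear_form_axis)
  have "has_bochner_integral std_gaussian
     (\<lambda>x. \<Sum>i\<in>UNIV. \<Sum>j\<in>UNIV. \<Sum>k\<in>UNIV. \<Sum>l\<in>UNIV.
        A $ i $ j * A $ k $ l * (x $ i * x $ j * (x $ k * x $ l)))
     (\<Sum>i\<in>UNIV. \<Sum>j\<in>UNIV. \<Sum>k\<in>UNIV. \<Sum>l\<in>UNIV.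
        A $ i $ j * A $ k $ l *
          (of_bool (i = j \<and> k = l) + of_bool (i = k \<and> j = l) + of_bool (i = l \<and> j = k)))"
    by (intro has_bochner_integral_sum has_bochner_integral_mult_right std_gaussian_vec_moments)
  also have "(\<lambda>x. \<Sum>i\<in>UNIV. \<Sum>j\<in>UNIV. \<Sum>k\<in>UNIV. \<Sum>l\<in>UNIV.
        A $ i $ j * A $ k $ l * (x $ i * x $ j * (x $ k * x $ l))) = (\<lambda>x. (x \<bullet> (A *v x))\<^sup>2)"
    by (unfold bilinear_form_expand power2_eq_square, unfold sum_distrib_right,
        unfold sum_distrib_left, simp only: mult_ac)
  also have "(\<Sum>i\<in>UNIV. \<Sum>j\<in>UNIV. \<Sum>k\<in>UNIV. \<Sum>l\<in>UNIV.
        A $ i $ j * A $ k $ l *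
          (of_bool (i = j \<and> k = l) + of_bool (i = k \<and> j = l) + of_bool (i = l \<and> j = k)))
     = (\<Sum>i\<in>UNIV. \<Sum>k\<in>UNIV. A $ i $ i * A $ k $ k) + 2 * (\<Sum>i\<in>UNIV. \<Sum>j\<in>UNIV. (A $ i $ j)\<^sup>2)"
    (is "?L = ?D + 2 * ?F")
  proof -
    have d1: "(\<Sum>j\<in>UNIV. \<Sum>k\<in>UNIV. \<Sum>l\<in>UNIV. A $ i $ j * A $ k $ l * of_bool (i = j \<and> k = l))
        = (\<Sum>k\<in>UNIV. A $ i $ i * A $ k $ k)" for i
      by (subst sum.remove[of UNIV i]) (simp_all add: of_bool_conj)
    have d2: "(\<Sum>k\<in>UNIV. \<Sum>l\<in>UNIV. A $ i $ j * A $ k $ l * of_bool (i = k \<and> j = l)) = (A $ i $ j)\<^sup>2"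
      for i j
      by (subst sum.remove[of UNIV i]) (simp_all add: of_bool_conj power2_eq_square)
    have d3: "(\<Sum>k\<in>UNIV. \<Sum>l\<in>UNIV. A $ i $ j * A $ k $ l * of_bool (i = l \<and> j = k)) = (A $ i $ j)\<^sup>2"
      for i j
      by (subst sum.remove[of UNIV j]) (simp_all add: of_bool_conj power2_eq_square sym[of j i])
    show ?thesis
      by (simp only: distrib_left sum.distrib d1 d2 d3)
  qed
  finally have *: "has_bochner_integral std_gaussian (\<lambda>x. (x \<bullet> (A *v x))\<^sup>2) (?D + 2 * ?F)" .
  then show "integrable std_gaussian (\<lambda>x. (x \<bullet> (A *v x))\<^sup>2)"
    by (simp add: has_bochner_integral_iff)
  have D: "?D = (trace A)\<^sup>2" by (simp add: trace_def power2_eq_square sum_product)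
  have "?F \<le> ?D" by (intro sum_mono psd_matrix_entry_bound[OF A])
  then have "?D + 2 * ?F \<le> 3 * (trace A)\<^sup>2" using D by linarith
  then show "(\<integral>x. (x \<bullet> (A *v x))\<^sup>2 \<partial>std_gaussian) \<le> 3 * (trace A)\<^sup>2"
    using * by (simp add: has_bochner_integral_iff)
qed

lemma distr_std_gaussian_uminus:
  "distr std_gaussian borel uminus = (std_gaussian :: 'a::euclidean_space measure)"
proof (rule measure_eqI)
  fix B :: "'a set" assume "B \<in> sets (distr std_gaussian borel uminus)"
  then have [measurable]: "B \<in> sets borel" by simp
  define p where "p x = ennreal (\<Prod>b\<in>Basis. std_normal_density (x \<bullet> b))" for x :: 'a
  have [measurable]: "p \<in> borel_measurable borel" unfolding p_def by measurable
  have [measurable]: "uminus -` B \<in> sets borel"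
    using measurable_sets[of uminus borel borel B] by simp
  have p: "p (- x) = p x" for x by (simp add: p_def std_normal_density_def)
  have l: "lborel = distr lborel borel (uminus :: 'a \<Rightarrow> 'a)"
    using lborel_affine[of "-1" "0 :: 'a"] by (simp add: density_1)
  have "emeasure std_gaussian B = (\<integral>\<^sup>+x. p x * indicator B x \<partial>distr lborel borel uminus)"
    by (simp add: std_gaussian_def emeasure_density p_def[symmetric] l[symmetric])
  also have "\<dots> = (\<integral>\<^sup>+x. p x * indicator (uminus -` B) x \<partial>lborel)"
    by (subst nn_integral_distr) (auto simp: p indicator_vimage o_def intro!: nn_integral_cong split: split_indicator)
  also have "\<dots> = emeasure std_gaussian (uminus -` B)"
    by (simp add: std_gaussian_def p_def[symmetric] emeasure_density)
  also have "\<dots> = emeasure (distr std_gaussian borel uminus) B"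
    by (subst emeasure_distr) auto
  finally show "emeasure (distr std_gaussian borel uminus) B = emeasure std_gaussian B" by simp
qed simp

text \<open>Averaging over $x$ and $-x$ removes the terms of odd degree; the only mixed term left,
  $(v^{\top} A x)^2$, is bounded by the Cauchy-Schwarz inequality for the form of $A$.\<close>

lemma std_gaussian_shifted_quadratic_form_squared:
  fixes A :: "real ^ 'd ^ 'd"
  assumes A: "psd_matrix A"
  shows "integrable std_gaussian (\<lambda>x. ((v + s *\<^sub>R x) \<bullet> (A *v (v + s *\<^sub>R x)))\<^sup>2)"
    and "(\<integral>x. ((v + s *\<^sub>R x) \<bullet> (A *v (v + s *\<^sub>R x)))\<^sup>2 \<partial>std_gaussian)
      \<le> (v \<bullet> (A *v v))\<^sup>2 + 6 * s\<^sup>2 * (v \<bullet> (A *v v)) * trace A + 3 * s ^ 4 * (trace A)\<^sup>2"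
proof -
  interpret prob_space "std_gaussian :: (real ^ 'd) measure" by (rule prob_space_std_gaussian)
  have [simp]: "prob UNIV = 1" using prob_space by simp
  define q where "q x = x \<bullet> (A *v x)" for x
  define F where "F x = (q (v + s *\<^sub>R x))\<^sup>2" for x
  have q0: "0 \<le> q x" for x unfolding q_def by (rule psd_matrix_nonneg[OF A])
  have [measurable]: "q \<in> borel_measurable borel"
    unfolding q_def by (intro borel_measurable_continuous_onI continuous_intros)
  have [measurable]: "F \<in> borel_measurable borel" unfolding F_def by measurable
  define R where "R x = 2 * (q v)\<^sup>2 + 12 * s\<^sup>2 * q v * q x + 2 * s ^ 4 * (q x)\<^sup>2" for x
  have le: "F x + F (- x) \<le> R x" for x
  proof -
    define b where "b = v \<bullet> (A *v x)"
    have b: "b\<^sup>2 \<le> q v * q x"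
      unfolding b_def q_def by (rule psd_matrix_Cauchy_Schwarz[OF A])
    have e: "q (v + c *\<^sub>R x) = q v + 2 * c * b + c\<^sup>2 * q x" for c
      using psd_matrix_commute[OF A, of x v]
      by (simp add: q_def b_def matrix_vector_right_distrib matrix_vector_mult_scaleR inner_add_left
          inner_add_right power2_eq_square algebra_simps)
    have Fx: "F x = (q v + 2 * s * b + s\<^sup>2 * q x)\<^sup>2" "F (- x) = (q v - 2 * s * b + s\<^sup>2 * q x)\<^sup>2"
      using e[of s] e[of "- s"] by (simp_all add: F_def)
    have "F x + F (- x) = 2 * (q v)\<^sup>2 + 4 * s\<^sup>2 * q v * q x + 2 * s ^ 4 * (q x)\<^sup>2 + 8 * s\<^sup>2 * b\<^sup>2"
      unfolding Fx by (simp add: power2_eq_square power4_eq_xxxx algebra_simps)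
    also have "\<dots> \<le> R x"
      using mult_left_mono[OF b, of "8 * s\<^sup>2"] by (simp add: R_def algebra_simps)
    finally show ?thesis .
  qed
  have R: "integrable std_gaussian R"
    "expectation R \<le> 2 * (q v)\<^sup>2 + 12 * s\<^sup>2 * q v * trace A + 2 * s ^ 4 * (3 * (trace A)\<^sup>2)"
  proof -
    have i: "integrable std_gaussian q" "expectation q = trace A"
      using std_gaussian_quadratic_form[of A] by (simp_all add: has_bochner_integral_iff q_def[abs_def])
    have i2: "integrable std_gaussian (\<lambda>x. (q x)\<^sup>2)" "expectation (\<lambda>x. (q x)\<^sup>2) \<le> 3 * (trace A)\<^sup>2"
      using std_gaussian_quadratic_form_squared[OF A] by (simp_all add: q_def[abs_def])
    show "integrable std_gaussian R" unfolding R_def using i i2 by simp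
    have "expectation R = 2 * (q v)\<^sup>2 + 12 * s\<^sup>2 * q v * trace A + 2 * s ^ 4 * expectation (\<lambda>x. (q x)\<^sup>2)"
      unfolding R_def using i i2 by (simp add: prob_space)
    also have "\<dots> \<le> 2 * (q v)\<^sup>2 + 12 * s\<^sup>2 * q v * trace A + 2 * s ^ 4 * (3 * (trace A)\<^sup>2)"
      using mult_left_mono[OF i2(2), of "2 * s ^ 4"] by simp
    finally show "expectation R \<le> 2 * (q v)\<^sup>2 + 12 * s\<^sup>2 * q v * trace A + 2 * s ^ 4 * (3 * (trace A)\<^sup>2)" .
  qed
  have F: "integrable std_gaussian F"
  proof (rule Bochner_Integration.integrable_bound[OF R(1)])
    show "AE x in std_gaussian. norm (F x) \<le> norm (R x)"
    proof (rule AE_I2)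
      fix x
      have "0 \<le> F x" "0 \<le> F (- x)" by (simp_all add: F_def)
      then show "norm (F x) \<le> norm (R x)" using le[of x] by simp
    qed
  qed measurable
  then show "integrable std_gaussian (\<lambda>x. ((v + s *\<^sub>R x) \<bullet> (A *v (v + s *\<^sub>R x)))\<^sup>2)"
    by (simp add: F_def[abs_def] q_def)
  have Fm: "integrable std_gaussian (\<lambda>x. F (- x))" "expectation (\<lambda>x. F (- x)) = expectation F"
    using F integrable_distr_eq[of uminus std_gaussian borel F] integral_distr[of uminus std_gaussian borel F]
    by (simp_all add: distr_std_gaussian_uminus)
  have "2 * expectation F = expectation (\<lambda>x. F x + F (- x))"
    using F Fm by simp
  also have "\<dots> \<le> expectation R"
    using F Fm R le by (intro integral_mono) auto
  finally show "(\<integral>x. ((v + s *\<^sub>R x) \<bullet> (A *v (v + s *\<^sub>R x)))\<^sup>2 \<partial>std_gaussian)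
      \<le> (v \<bullet> (A *v v))\<^sup>2 + 6 * s\<^sup>2 * (v \<bullet> (A *v v)) * trace A + 3 * s ^ 4 * (trace A)\<^sup>2"
    using R(2) by (simp add: F_def[abs_def] q_def)
qed

section \<open>Control of all Gaussian averages by one exponential integral\<close>

text \<open>A form of the Donsker-Varadhan inequality: $|v|^2/(2s^2)$ is the Kullback-Leibler divergence
  between the Gaussian laws of covariance $s^2 I$ centred at $v$ and at the origin. The hypothesis
  does not involve $v$, so the conclusion holds for all $v$ simultaneously.\<close>

lemma gaussian_smoothing_bound:
  fixes h :: "real ^ 'd \<Rightarrow> real"
  assumes [measurable]: "h \<in> borel_measurable borel" and s: "0 < s"
    and int: "integrable std_gaussian (\<lambda>x. h (v + s *\<^sub>R x))"
    and le: "(\<integral>\<^sup>+x. ennreal (exp (h (s *\<^sub>R x))) \<partial>std_gaussian) \<le> ennreal (exp t)"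
  shows "(\<integral>x. h (v + s *\<^sub>R x) \<partial>std_gaussian) \<le> t + (norm v)\<^sup>2 / (2 * s\<^sup>2)"
proof -
  interpret prob_space "std_gaussian :: (real ^ 'd) measure" by (rule prob_space_std_gaussian)
  have [simp]: "prob UNIV = 1" using prob_space by simp
  \<comment> \<open>\<open>Y\<close> is the exponent after translation by \<open>u\<close>, as $s (u + x) = v + s x$\<close>
  define u where "u = (1 / s) *\<^sub>R v"
  have su: "s *\<^sub>R u = v" using s by (simp add: u_def)
  have uu: "u \<bullet> u = (norm v)\<^sup>2 / s\<^sup>2" by (simp add: u_def dot_square_norm power2_eq_square)
  define Y where "Y x = h (v + s *\<^sub>R x) - (u \<bullet> x) - (u \<bullet> u) / 2" for x
  have ux: "integrable std_gaussian (\<lambda>x. u \<bullet> x)" "expectation (\<lambda>x. u \<bullet> x) = 0"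
    using std_gaussian_inner[of u] by (simp_all add: has_bochner_integral_iff)
  have Y: "integrable std_gaussian Y" unfolding Y_def using int ux by simp
  have EY: "expectation Y = expectation (\<lambda>x. h (v + s *\<^sub>R x)) - (u \<bullet> u) / 2"
    unfolding Y_def using int ux by (simp add: prob_space)
  have "ennreal (exp (expectation Y)) \<le> (\<integral>\<^sup>+x. ennreal (exp (Y x)) \<partial>std_gaussian)"
    by (rule exp_expectation_le_nn_integral_exp[OF Y])
  also have "\<dots> = (\<integral>\<^sup>+x. ennreal (exp (h (s *\<^sub>R (u + x)))) * ennreal (exp (- (u \<bullet> x) - (u \<bullet> u) / 2)) \<partial>std_gaussian)"
    by (intro nn_integral_cong)
      (simp add: Y_def ennreal_mult[symmetric] exp_add[symmetric] scaleR_add_right su)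
  also have "\<dots> = (\<integral>\<^sup>+x. ennreal (exp (h (s *\<^sub>R x))) \<partial>std_gaussian)"
    by (rule nn_integral_std_gaussian_shift[symmetric]) measurable
  also note le
  finally have "expectation Y \<le> t" by simp
  then show ?thesis using EY uu by simp
qed

section \<open>Soft truncation and compensated forms\<close>

lemma bounded_linear_bilinear_form:
  "bounded_linear (\<lambda>A :: real ^ 'd ^ 'd. x \<bullet> (A *v y))"
  unfolding linear_conv_bounded_linear[symmetric]
  by (rule linearI)
    (simp_all add: matrix_vector_mult_add_rdistrib scaleR_matrix_vector_assoc[symmetric] inner_add_right)

lemma bounded_linear_trace: "bounded_linear (trace :: real ^ 'd ^ 'd \<Rightarrow> real)"
  unfolding linear_conv_bounded_linear[symmetric]
  by (rule linearI) (simp_all add: trace_def sum.distrib sum_distrib_left)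

lemma borel_measurable_trace [measurable]: "(trace :: real ^ 'd ^ 'd \<Rightarrow> real) \<in> borel_measurable borel"
  by (intro borel_measurable_continuous_onI linear_continuous_on bounded_linear_trace)

lemma borel_measurable_bilinear_form [measurable]:
  "(\<lambda>A :: real ^ 'd ^ 'd. x \<bullet> (A *v y)) \<in> borel_measurable borel"
  by (intro borel_measurable_continuous_onI linear_continuous_on bounded_linear_bilinear_form)

lemma borel_measurable_quadratic_form_pair [measurable]:
  "(\<lambda>(A :: real ^ 'd ^ 'd, x). x \<bullet> (A *v x)) \<in> borel_measurable (borel \<Otimes>\<^sub>M borel)"
  unfolding borel_prod bilinear_form_expand case_prod_unfold
  by (intro borel_measurable_continuous_onI continuous_intros)

lemma closed_psd_matrix: "closed {A :: real ^ 'd ^ 'd. psd_matrix A}"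
proof -
  have "{A :: real ^ 'd ^ 'd. psd_matrix A} =
      (\<Inter>i. \<Inter>j. {A. A $ j $ i = A $ i $ j}) \<inter> (\<Inter>x. {A. 0 \<le> x \<bullet> (A *v x)})"
    by (auto simp: psd_matrix_def transpose_def vec_eq_iff)
  moreover have "closed {A :: real ^ 'd ^ 'd. 0 \<le> x \<bullet> (A *v x)}" for x
    by (intro closed_Collect_le continuous_on_const linear_continuous_on bounded_linear_bilinear_form)
  moreover have "closed {A :: real ^ 'd ^ 'd. A $ j $ i = A $ i $ j}" for i j
    by (intro closed_Collect_eq continuous_intros)
  ultimately show ?thesis by (simp only: closed_Int closed_INT ball_UNIV simp_thms)
qed

lemma sets_psd_matrix [measurable]: "{A :: real ^ 'd ^ 'd. psd_matrix A} \<in> sets borel"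
  by (intro borel_closed closed_psd_matrix)

text \<open>Shrinks a positive semi-definite matrix so that its trace is at most \<open>S\<close>. Unlike a hard
  cut-off, the factor depends on the trace without a case distinction. The value is irrelevant
  when $S + \mathrm{Tr}\,A \le 0$, which does not occur for positive semi-definite \<open>A\<close> and $S > 0$.\<close>

definition soft_trunc :: "real \<Rightarrow> real ^ 'd ^ 'd \<Rightarrow> real ^ 'd ^ 'd" where
  "soft_trunc S A = (S / (S + trace A)) *\<^sub>R A"

lemma borel_measurable_soft_trunc [measurable]: "soft_trunc S \<in> borel_measurable borel"
  unfolding soft_trunc_def by measurable

lemma quadratic_form_soft_trunc: "x \<bullet> (soft_trunc S A *v x) = S / (S + trace A) * (x \<bullet> (A *v x))"
  by (simp add: soft_trunc_def scaleR_matrix_vector_assoc[symmetric])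

lemma trace_soft_trunc: "trace (soft_trunc S A) = S / (S + trace A) * trace A"
  by (simp add: soft_trunc_def trace_def sum_distrib_left)

context
  fixes A :: "real ^ 'd ^ 'd" and S :: real
  assumes A: "psd_matrix A" and S: "0 < S"
begin

lemma soft_trunc_factor: "0 \<le> S / (S + trace A)" "S / (S + trace A) \<le> 1"
  using psd_matrix_trace_nonneg[OF A] S by simp_all

lemma soft_trunc_quadratic_form_nonneg: "0 \<le> x \<bullet> (soft_trunc S A *v x)"
  unfolding quadratic_form_soft_trunc by (rule mult_nonneg_nonneg[OF soft_trunc_factor(1) psd_matrix_nonneg[OF A]])

lemma soft_trunc_quadratic_form_le: "x \<bullet> (soft_trunc S A *v x) \<le> x \<bullet> (A *v x)"
  unfolding quadratic_form_soft_trunc by (rule mult_left_le_one_le[OF psd_matrix_nonneg[OF A] soft_trunc_factor])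

lemma soft_trunc_trace_nonneg: "0 \<le> trace (soft_trunc S A)"
  unfolding trace_soft_trunc by (rule mult_nonneg_nonneg[OF soft_trunc_factor(1) psd_matrix_trace_nonneg[OF A]])

lemma soft_trunc_trace_le: "trace (soft_trunc S A) \<le> trace A"
  unfolding trace_soft_trunc by (rule mult_left_le_one_le[OF psd_matrix_trace_nonneg[OF A] soft_trunc_factor])

lemma soft_trunc_trace_le_level: "trace (soft_trunc S A) \<le> S"
  unfolding trace_soft_trunc using psd_matrix_trace_nonneg[OF A] S
  by (simp add: field_simps)

lemma soft_trunc_quadratic_form_deficit:
  "x \<bullet> (A *v x) - x \<bullet> (soft_trunc S A *v x) \<le> (x \<bullet> (A *v x)) * trace A / S"
proof -
  have t: "0 \<le> trace A" by (rule psd_matrix_trace_nonneg[OF A])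
  have "1 - S / (S + trace A) = trace A / (S + trace A)" using t S by (simp add: field_simps)
  also have "\<dots> \<le> trace A / S" using t S by (intro divide_left_mono) auto
  finally have "(1 - S / (S + trace A)) * (x \<bullet> (A *v x)) \<le> trace A / S * (x \<bullet> (A *v x))"
    by (intro mult_right_mono psd_matrix_nonneg[OF A])
  then show ?thesis by (simp add: quadratic_form_soft_trunc algebra_simps)
qed

lemma norm_soft_trunc_le: "norm (soft_trunc S A) \<le> norm A"
  unfolding soft_trunc_def norm_scaleR real_norm_def abs_of_nonneg[OF soft_trunc_factor(1)]
  by (rule mult_left_le_one_le[OF norm_ge_zero soft_trunc_factor])

end

text \<open>The negative of the quadratic form, with the compensator that makes its mean under the
  Gaussian law centred at $v$ with covariance $s^2 I$ equal to $-v^{\top} A v$.\<close>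

definition compensated_form :: "real \<Rightarrow> real ^ 'd ^ 'd \<Rightarrow> real ^ 'd \<Rightarrow> real" where
  "compensated_form s A x = s\<^sup>2 * trace A - x \<bullet> (A *v x)"

lemma borel_measurable_compensated_form_pair [measurable]:
  "(\<lambda>(A, x). compensated_form s A x) \<in> borel_measurable (borel \<Otimes>\<^sub>M borel)"
proof -
  have "(\<lambda>p. s\<^sup>2 * trace (fst p) - (\<lambda>(A, x). x \<bullet> (A *v x)) p) \<in> borel_measurable (borel \<Otimes>\<^sub>M borel)"
    by measurable
  then show ?thesis by (simp add: compensated_form_def case_prod_unfold)
qed

lemma borel_measurable_compensated_form [measurable (raw)]:
  assumes [measurable]: "f \<in> borel_measurable M" "g \<in> borel_measurable M"
  shows "(\<lambda>x. compensated_form s (f x) (g x)) \<in> borel_measurable M"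
proof -
  have "(\<lambda>x. (\<lambda>(A, x). compensated_form s A x) (f x, g x)) \<in> borel_measurable M" by measurable
  then show ?thesis by simp
qed

lemma std_gaussian_compensated_form:
  fixes A :: "real ^ 'd ^ 'd"
  shows "has_bochner_integral std_gaussian (\<lambda>x. compensated_form s A (v + s *\<^sub>R x)) (- (v \<bullet> (A *v v)))"
proof -
  interpret prob_space "std_gaussian :: (real ^ 'd) measure" by (rule prob_space_std_gaussian)
  have [simp]: "prob UNIV = 1" using prob_space by simp
  have "has_bochner_integral std_gaussian (\<lambda>x::real^'d. s\<^sup>2 * trace A) (s\<^sup>2 * trace A)"
    by (simp add: has_bochner_integral_iff)
  from has_bochner_integral_diff[OF this std_gaussian_shifted_quadratic_form[of v s A]]
  show ?thesis by (simp add: compensated_form_def)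
qed

section \<open>Moments of the random matrix\<close>

text \<open>A positive semi-definite random matrix with mean \<open>\<Sigma>\<close> whose quadratic forms have $L_2$ norms
  at most $\kappa^2$ times their means.\<close>

locale psd_random_matrix = prob_space Q for Q :: "'b measure" +
  fixes M :: "'b \<Rightarrow> real ^ 'd ^ 'd" and \<Sigma> :: "real ^ 'd ^ 'd" and \<kappa> :: real
  assumes measurable_M [measurable]: "M \<in> borel_measurable Q"
    and psd_M: "AE \<omega> in Q. psd_matrix (M \<omega>)"
    and integrable_M: "integrable Q M" and mean_M: "expectation M = \<Sigma>"
    and integrable_square: "integrable Q (\<lambda>\<omega>. (x \<bullet> (M \<omega> *v x))\<^sup>2)"
    and moment_bound: "sqrt (expectation (\<lambda>\<omega>. (x \<bullet> (M \<omega> *v x))\<^sup>2)) \<le> \<kappa>\<^sup>2 * (x \<bullet> (\<Sigma> *v x))"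
begin

lemma expectation_bilinear_form:
  fixes F :: "'b \<Rightarrow> real ^ 'd ^ 'd"
  assumes "integrable Q F"
  shows "integrable Q (\<lambda>\<omega>. x \<bullet> (F \<omega> *v y))"
    and "expectation (\<lambda>\<omega>. x \<bullet> (F \<omega> *v y)) = x \<bullet> (expectation F *v y)"
  using integrable_bounded_linear[OF bounded_linear_bilinear_form assms]
    integral_bounded_linear[OF bounded_linear_bilinear_form assms] by blast+

lemma psd_mean: "psd_matrix \<Sigma>"
  unfolding psd_matrix_def
proof (intro conjI allI)
  fix x
  have "0 \<le> expectation (\<lambda>\<omega>. x \<bullet> (M \<omega> *v x))"
    using psd_M by (intro integral_nonneg_AE) (auto elim!: eventually_mono simp: psd_matrix_nonneg)
  then show "0 \<le> x \<bullet> (\<Sigma> *v x)"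
    by (simp add: expectation_bilinear_form[OF integrable_M] mean_M)
next
  have "\<Sigma> $ j $ i = \<Sigma> $ i $ j" for i j
  proof -
    have "expectation (\<lambda>\<omega>. axis j 1 \<bullet> (M \<omega> *v axis i 1)) = expectation (\<lambda>\<omega>. axis i 1 \<bullet> (M \<omega> *v axis j 1))"
      using psd_M by (intro integral_cong_AE) (auto elim!: eventually_mono intro: psd_matrix_commute)
    then have "axis j 1 \<bullet> (\<Sigma> *v axis i 1) = axis i 1 \<bullet> (\<Sigma> *v axis j 1)"
      unfolding expectation_bilinear_form[OF integrable_M] mean_M .
    then show ?thesis by (simp only: bilinear_form_axis)
  qed
  then show "transpose \<Sigma> = \<Sigma>" by (simp add: transpose_def vec_eq_iff)
qed

lemma expectation_product_of_forms:
  shows "integrable Q (\<lambda>\<omega>. (x \<bullet> (M \<omega> *v x)) * (y \<bullet> (M \<omega> *v y)))"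
    and "expectation (\<lambda>\<omega>. (x \<bullet> (M \<omega> *v x)) * (y \<bullet> (M \<omega> *v y)))
      \<le> \<kappa> ^ 4 * ((x \<bullet> (\<Sigma> *v x)) * (y \<bullet> (\<Sigma> *v y)))"
proof -
  have m: "(\<lambda>\<omega>. z \<bullet> (M \<omega> *v z)) \<in> borel_measurable Q" for z by measurable
  note CS = integral_Cauchy_Schwarz[OF m m integrable_square integrable_square, of x y]
  show "integrable Q (\<lambda>\<omega>. (x \<bullet> (M \<omega> *v x)) * (y \<bullet> (M \<omega> *v y)))" by (rule CS(1))
  have "expectation (\<lambda>\<omega>. (x \<bullet> (M \<omega> *v x)) * (y \<bullet> (M \<omega> *v y)))
      \<le> sqrt (expectation (\<lambda>\<omega>. (x \<bullet> (M \<omega> *v x))\<^sup>2) * expectation (\<lambda>\<omega>. (y \<bullet> (M \<omega> *v y))\<^sup>2))"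
    using CS(2) by (rule real_le_rsqrt)
  also have "\<dots> \<le> (\<kappa>\<^sup>2 * (x \<bullet> (\<Sigma> *v x))) * (\<kappa>\<^sup>2 * (y \<bullet> (\<Sigma> *v y)))"
    unfolding real_sqrt_mult
    by (intro mult_mono moment_bound) (simp_all add: psd_matrix_nonneg[OF psd_mean])
  finally show "expectation (\<lambda>\<omega>. (x \<bullet> (M \<omega> *v x)) * (y \<bullet> (M \<omega> *v y)))
      \<le> \<kappa> ^ 4 * ((x \<bullet> (\<Sigma> *v x)) * (y \<bullet> (\<Sigma> *v y)))"
    by (simp add: power2_eq_square power4_eq_xxxx mult_ac)
qed

lemma expectation_form_squared:
  "expectation (\<lambda>\<omega>. (x \<bullet> (M \<omega> *v x))\<^sup>2) \<le> \<kappa> ^ 4 * (x \<bullet> (\<Sigma> *v x))\<^sup>2"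
  using expectation_product_of_forms(2)[of x x] by (simp add: power2_eq_square)

lemma expectation_form_times_trace:
  shows "integrable Q (\<lambda>\<omega>. (x \<bullet> (M \<omega> *v x)) * trace (M \<omega>))"
    and "expectation (\<lambda>\<omega>. (x \<bullet> (M \<omega> *v x)) * trace (M \<omega>)) \<le> \<kappa> ^ 4 * ((x \<bullet> (\<Sigma> *v x)) * trace \<Sigma>)"
  using expectation_product_of_forms[of x]
  by (simp_all add: trace_eq_sum_quadratic_form sum_distrib_left Bochner_Integration.integral_sum sum_mono)

lemma expectation_trace_squared:
  shows "integrable Q (\<lambda>\<omega>. (trace (M \<omega>))\<^sup>2)"
    and "expectation (\<lambda>\<omega>. (trace (M \<omega>))\<^sup>2) \<le> \<kappa> ^ 4 * (trace \<Sigma>)\<^sup>2"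
proof -
  have eq: "(trace (M \<omega>))\<^sup>2 = (\<Sum>i\<in>UNIV. (axis i 1 \<bullet> (M \<omega> *v axis i 1)) * trace (M \<omega>))" for \<omega>
    by (simp add: power2_eq_square sum_distrib_right[symmetric] trace_eq_sum_quadratic_form[symmetric])
  show "integrable Q (\<lambda>\<omega>. (trace (M \<omega>))\<^sup>2)"
    unfolding eq by (intro Bochner_Integration.integrable_sum expectation_form_times_trace)
  have "expectation (\<lambda>\<omega>. (trace (M \<omega>))\<^sup>2) \<le>
      (\<Sum>i\<in>UNIV. \<kappa> ^ 4 * ((axis i 1 \<bullet> (\<Sigma> *v axis i 1)) * trace \<Sigma>))"
    unfolding eq
    by (subst Bochner_Integration.integral_sum) (intro expectation_form_times_trace sum_mono)+
  also have "\<dots> = \<kappa> ^ 4 * (trace \<Sigma>)\<^sup>2"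
    by (simp add: power2_eq_square sum_distrib_right[symmetric] sum_distrib_left[symmetric]
        trace_eq_sum_quadratic_form[symmetric])
  finally show "expectation (\<lambda>\<omega>. (trace (M \<omega>))\<^sup>2) \<le> \<kappa> ^ 4 * (trace \<Sigma>)\<^sup>2" .
qed

lemma integrable_soft_trunc:
  assumes "0 < S"
  shows "integrable Q (\<lambda>\<omega>. soft_trunc S (M \<omega>))"
proof (rule Bochner_Integration.integrable_bound[OF integrable_M])
  show "AE \<omega> in Q. norm (soft_trunc S (M \<omega>)) \<le> norm (M \<omega>)"
    using psd_M by (rule eventually_mono) (rule norm_soft_trunc_le[OF _ assms])
qed measurable

text \<open>The loss in the mean form caused by the truncation.\<close>

lemma truncation_bias:
  assumes S: "0 < S"
  shows "x \<bullet> (\<Sigma> *v x) - x \<bullet> (expectation (\<lambda>\<omega>. soft_trunc S (M \<omega>)) *v x)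
    \<le> \<kappa> ^ 4 * ((x \<bullet> (\<Sigma> *v x)) * trace \<Sigma>) / S"
proof -
  note i = expectation_bilinear_form[OF integrable_M] expectation_bilinear_form[OF integrable_soft_trunc[OF S]]
  have "x \<bullet> (\<Sigma> *v x) - x \<bullet> (expectation (\<lambda>\<omega>. soft_trunc S (M \<omega>)) *v x)
     = expectation (\<lambda>\<omega>. x \<bullet> (M \<omega> *v x) - x \<bullet> (soft_trunc S (M \<omega>) *v x))"
    using i by (simp add: mean_M)
  also have "\<dots> \<le> expectation (\<lambda>\<omega>. (x \<bullet> (M \<omega> *v x)) * trace (M \<omega>) / S)"
    using i expectation_form_times_trace(1)[of x] psd_M
    by (intro integral_mono_AE)
      (auto elim!: eventually_mono intro!: soft_trunc_quadratic_form_deficit S)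
  also have "\<dots> \<le> \<kappa> ^ 4 * ((x \<bullet> (\<Sigma> *v x)) * trace \<Sigma>) / S"
    using expectation_form_times_trace(2)[of x] S by (simp add: divide_right_mono)
  finally show ?thesis .
qed

section \<open>The exponential moment\<close>

text \<open>The upper bound for the logarithmic moment generating function at \<open>\<eta>\<close> of the compensated form
  of the truncated matrix at \<open>x\<close>: the exact mean plus a bound for the second moment.\<close>

definition log_mgf_bound :: "real \<Rightarrow> real \<Rightarrow> real \<Rightarrow> real ^ 'd \<Rightarrow> real" where
  "log_mgf_bound \<eta> s S x = \<eta> * compensated_form s (expectation (\<lambda>\<omega>. soft_trunc S (M \<omega>))) x
     + \<eta>\<^sup>2 * (\<kappa> ^ 4 * (s ^ 4 * (trace \<Sigma>)\<^sup>2 + (x \<bullet> (\<Sigma> *v x))\<^sup>2))"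

text \<open>The truncation is needed only for the upper bound $\eta s^2 S \le 1$ of the exponent, which
  brings it into the range of \<open>exp_le_quadratic\<close>; second moments are then taken of the
  untruncated matrix.\<close>

lemma exponential_moment:
  assumes \<eta>: "0 \<le> \<eta>" and S: "0 < S" and bd: "\<eta> * (s\<^sup>2 * S) \<le> 1"
  shows "(\<integral>\<^sup>+\<omega>. ennreal (exp (\<eta> * compensated_form s (soft_trunc S (M \<omega>)) x - log_mgf_bound \<eta> s S x)) \<partial>Q) \<le> 1"
proof -
  define K where "K = log_mgf_bound \<eta> s S x"
  define Z where "Z \<omega> = \<eta> * compensated_form s (soft_trunc S (M \<omega>)) x" for \<omega>
  define W where "W \<omega> = s ^ 4 * (trace (M \<omega>))\<^sup>2 + (x \<bullet> (M \<omega> *v x))\<^sup>2" for \<omega>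
  define U where "U \<omega> = 1 + Z \<omega> + \<eta>\<^sup>2 * W \<omega>" for \<omega>
  have Z: "integrable Q Z" "expectation Z = \<eta> * compensated_form s (expectation (\<lambda>\<omega>. soft_trunc S (M \<omega>))) x"
  proof -
    note i = expectation_bilinear_form[OF integrable_soft_trunc[OF S], of x x]
      integrable_bounded_linear[OF bounded_linear_trace integrable_soft_trunc[OF S]]
      integral_bounded_linear[OF bounded_linear_trace integrable_soft_trunc[OF S]]
    show "integrable Q Z" "expectation Z = \<eta> * compensated_form s (expectation (\<lambda>\<omega>. soft_trunc S (M \<omega>))) x"
      unfolding Z_def compensated_form_def using i by simp_all
  qed
  have W: "integrable Q W" "expectation W \<le> \<kappa> ^ 4 * (s ^ 4 * (trace \<Sigma>)\<^sup>2 + (x \<bullet> (\<Sigma> *v x))\<^sup>2)"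
  proof -
    show "integrable Q W" unfolding W_def using expectation_trace_squared(1) integrable_square[of x] by simp
    have "expectation W = s ^ 4 * expectation (\<lambda>\<omega>. (trace (M \<omega>))\<^sup>2) + expectation (\<lambda>\<omega>. (x \<bullet> (M \<omega> *v x))\<^sup>2)"
      unfolding W_def using expectation_trace_squared(1) integrable_square[of x] by simp
    also have "\<dots> \<le> s ^ 4 * (\<kappa> ^ 4 * (trace \<Sigma>)\<^sup>2) + \<kappa> ^ 4 * (x \<bullet> (\<Sigma> *v x))\<^sup>2"
      by (intro add_mono mult_left_mono expectation_trace_squared expectation_form_squared) simp
    finally show "expectation W \<le> \<kappa> ^ 4 * (s ^ 4 * (trace \<Sigma>)\<^sup>2 + (x \<bullet> (\<Sigma> *v x))\<^sup>2)"
      by (simp add: algebra_simps)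
  qed
  have U: "integrable Q U" unfolding U_def using Z W by simp
  have "expectation U = 1 + expectation Z + \<eta>\<^sup>2 * expectation W"
    unfolding U_def using Z W by (simp add: prob_space)
  also have "\<dots> \<le> 1 + K"
    unfolding K_def log_mgf_bound_def using Z(2) mult_left_mono[OF W(2), of "\<eta>\<^sup>2"] by simp
  also have "\<dots> \<le> exp K" by (rule exp_ge_add_one_self)
  finally have EU: "expectation U \<le> exp K" .
  have expZ: "AE \<omega> in Q. exp (Z \<omega>) \<le> U \<omega>"
    using psd_M
  proof (rule eventually_mono)
    fix \<omega> assume A: "psd_matrix (M \<omega>)"
    define p where "p = s\<^sup>2 * trace (soft_trunc S (M \<omega>))"
    define q where "q = x \<bullet> (soft_trunc S (M \<omega>) *v x)"
    have p: "0 \<le> p" "p \<le> s\<^sup>2 * trace (M \<omega>)" "p \<le> s\<^sup>2 * S"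
      unfolding p_def using soft_trunc_trace_nonneg[OF A S] soft_trunc_trace_le[OF A S] soft_trunc_trace_le_level[OF A S]
      by (auto intro: mult_left_mono)
    have q: "0 \<le> q" "q \<le> x \<bullet> (M \<omega> *v x)"
      unfolding q_def by (rule soft_trunc_quadratic_form_nonneg[OF A S], rule soft_trunc_quadratic_form_le[OF A S])
    have Zpq: "Z \<omega> = \<eta> * (p - q)" by (simp add: Z_def compensated_form_def p_def q_def)
    have "\<eta> * (p - q) \<le> \<eta> * (s\<^sup>2 * S)" using p q \<eta> by (intro mult_left_mono) auto
    then have "Z \<omega> \<le> 1" using bd Zpq by linarith
    then have "exp (Z \<omega>) \<le> 1 + Z \<omega> + (Z \<omega>)\<^sup>2" by (rule exp_le_quadratic)
    also have "(Z \<omega>)\<^sup>2 \<le> \<eta>\<^sup>2 * W \<omega>"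
    proof -
      \<comment> \<open>both terms are nonnegative, so their difference costs no factor 2\<close>
      have "(p - q)\<^sup>2 \<le> p\<^sup>2 + q\<^sup>2" using p q by (simp add: power2_diff)
      also have "\<dots> \<le> (s\<^sup>2 * trace (M \<omega>))\<^sup>2 + (x \<bullet> (M \<omega> *v x))\<^sup>2"
        using p q by (intro add_mono power_mono)
      also have "\<dots> = W \<omega>" by (simp add: W_def power_mult_distrib power2_eq_square power4_eq_xxxx)
      finally show ?thesis unfolding Zpq power_mult_distrib by (rule mult_left_mono) simp
    qed
    finally show "exp (Z \<omega>) \<le> U \<omega>" by (simp add: U_def)
  qed
  have "(\<integral>\<^sup>+\<omega>. ennreal (exp (Z \<omega> - K)) \<partial>Q) \<le> (\<integral>\<^sup>+\<omega>. ennreal (exp (- K) * U \<omega>) \<partial>Q)"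
    using expZ
    by (intro nn_integral_mono_AE, elim eventually_mono)
      (auto simp: exp_diff exp_minus field_simps intro!: ennreal_leI divide_right_mono)
  also have "\<dots> = ennreal (\<integral>\<omega>. exp (- K) * U \<omega> \<partial>Q)"
    using U expZ
    by (intro nn_integral_eq_integral)
      (auto elim!: eventually_mono intro!: mult_nonneg_nonneg intro: order_trans[OF exp_ge_zero])
  also have "\<dots> \<le> 1"
    using EU by (simp add: exp_minus field_simps)
  finally show ?thesis by (simp add: Z_def K_def)
qed

end

section \<open>The smoothed empirical process\<close>

context psd_random_matrix
begin

text \<open>The exponent $h$ that is smoothed: the sum over the sample of the compensated forms of the
  truncated matrices, each reduced by its logarithmic moment generating function bound.\<close>

definition excess ::
  "real \<Rightarrow> real \<Rightarrow> real \<Rightarrow> ('i \<Rightarrow> 'c \<Rightarrow> real ^ 'd ^ 'd) \<Rightarrow> 'i set \<Rightarrow> 'c \<Rightarrow> real ^ 'd \<Rightarrow> real" where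
  "excess \<eta> s S X I \<omega> x = (\<Sum>i\<in>I. \<eta> * compensated_form s (soft_trunc S (X i \<omega>)) x - log_mgf_bound \<eta> s S x)"

lemma borel_measurable_log_mgf_bound [measurable]: "log_mgf_bound \<eta> s S \<in> borel_measurable borel"
proof -
  have "(\<lambda>x. x \<bullet> (\<Sigma> *v x)) \<in> borel_measurable borel"
    by (intro borel_measurable_continuous_onI continuous_intros)
  then show ?thesis unfolding log_mgf_bound_def[abs_def] by measurable
qed

lemma smoothed_exponential_bound:
  fixes P :: "'c measure"
  assumes P: "prob_space P" and I: "finite I"
    and indep: "prob_space.indep_vars P (\<lambda>_. borel) X I"
    and distr: "\<And>i. i \<in> I \<Longrightarrow> distr P borel (X i) = distr Q borel M"
    and \<eta>: "0 \<le> \<eta>" and S: "0 < S" and bd: "\<eta> * (s\<^sup>2 * S) \<le> 1"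
  defines "H \<equiv> \<lambda>\<omega>. \<integral>\<^sup>+x. ennreal (exp (excess \<eta> s S X I \<omega> (s *\<^sub>R x))) \<partial>std_gaussian"
  shows "H \<in> borel_measurable P"
    and "measure P {\<omega> \<in> space P. H \<omega> \<le> ennreal (exp t)} \<ge> 1 - exp (- t)"
proof -
  interpret P: prob_space P by fact
  interpret G: prob_space "std_gaussian :: (real ^ 'd) measure" by (rule prob_space_std_gaussian)
  interpret PG: pair_sigma_finite P "std_gaussian :: (real ^ 'd) measure" ..
  have X [measurable]: "X i \<in> borel_measurable P" if "i \<in> I" for i
    using indep that by (auto simp: P.indep_vars_def)
  have [measurable]: "(\<lambda>(\<omega>, x). ennreal (exp (excess \<eta> s S X I \<omega> (s *\<^sub>R x))))
      \<in> borel_measurable (P \<Otimes>\<^sub>M std_gaussian)"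
    unfolding excess_def by measurable
  show H [measurable]: "H \<in> borel_measurable P" unfolding H_def by measurable
  have one: "(\<integral>\<^sup>+\<omega>. ennreal (exp (excess \<eta> s S X I \<omega> x)) \<partial>P) \<le> 1" for x
  proof -
    define g where "g A = ennreal (exp (\<eta> * compensated_form s (soft_trunc S A) x - log_mgf_bound \<eta> s S x))" for A
    have [measurable]: "g \<in> borel_measurable borel" unfolding g_def by measurable
    have "(\<integral>\<^sup>+\<omega>. ennreal (exp (excess \<eta> s S X I \<omega> x)) \<partial>P) = (\<integral>\<^sup>+\<omega>. (\<Prod>i\<in>I. g (X i \<omega>)) \<partial>P)"
      by (simp add: excess_def g_def exp_sum I prod_ennreal)
    also have "\<dots> = (\<Prod>i\<in>I. \<integral>\<^sup>+\<omega>. g (X i \<omega>) \<partial>P)"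
      using I P.indep_vars_compose2[OF indep, of "\<lambda>_. g" "\<lambda>_. borel"]
      by (intro P.indep_vars_nn_integral) auto
    also have "\<dots> \<le> 1"
    proof -
      have "(\<integral>\<^sup>+\<omega>. g (X i \<omega>) \<partial>P) \<le> 1" if i: "i \<in> I" for i
      proof -
        have "(\<integral>\<^sup>+\<omega>. g (X i \<omega>) \<partial>P) = (\<integral>\<^sup>+A. g A \<partial>distr P borel (X i))"
          using X[OF i] by (subst nn_integral_distr) auto
        also have "\<dots> = (\<integral>\<^sup>+\<omega>. g (M \<omega>) \<partial>Q)"
          unfolding distr[OF i] by (subst nn_integral_distr) auto
        also have "\<dots> \<le> 1"
          unfolding g_def by (rule exponential_moment[OF \<eta> S bd])
        finally show ?thesis .
      qed
      with I show ?thesis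
      proof (induction I rule: finite_induct)
        case (insert i J)
        then show ?case
          using mult_mono[of "\<integral>\<^sup>+\<omega>. g (X i \<omega>) \<partial>P" 1 "\<Prod>i\<in>J. \<integral>\<^sup>+\<omega>. g (X i \<omega>) \<partial>P" 1] by simp
      qed simp
    qed
    finally show ?thesis .
  qed
  have "(\<integral>\<^sup>+\<omega>. H \<omega> \<partial>P) = (\<integral>\<^sup>+x. \<integral>\<^sup>+\<omega>. ennreal (exp (excess \<eta> s S X I \<omega> (s *\<^sub>R x))) \<partial>P \<partial>std_gaussian)"
    unfolding H_def by (rule PG.Fubini'[symmetric]) measurable
  also have "\<dots> \<le> (\<integral>\<^sup>+x. 1 \<partial>(std_gaussian :: (real ^ 'd) measure))"
    by (intro nn_integral_mono one)
  also have "\<dots> = 1" using G.emeasure_space_1 by simp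
  finally have EH: "(\<integral>\<^sup>+\<omega>. H \<omega> \<partial>P) \<le> 1" .
  define E where "E = {\<omega> \<in> space P. H \<omega> \<le> ennreal (exp t)}"
  have E [measurable]: "E \<in> sets P" unfolding E_def by measurable
  have "emeasure P (space P - E) \<le> emeasure P ({\<omega> \<in> space P. 1 \<le> ennreal (exp (- t)) * H \<omega>})"
  proof (rule emeasure_mono)
    show "space P - E \<subseteq> {\<omega> \<in> space P. 1 \<le> ennreal (exp (- t)) * H \<omega>}"
    proof safe
      fix \<omega> assume "\<omega> \<in> space P" "\<omega> \<notin> E"
      then have "ennreal (exp t) \<le> H \<omega>" by (auto simp: E_def)
      then have "ennreal (exp (- t)) * ennreal (exp t) \<le> ennreal (exp (- t)) * H \<omega>"
        by (rule mult_left_mono) simp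
      then show "1 \<le> ennreal (exp (- t)) * H \<omega>"
        by (simp add: ennreal_mult[symmetric] exp_minus)
    qed
  qed measurable
  also have "\<dots> \<le> ennreal (exp (- t)) * (\<integral>\<^sup>+\<omega>. H \<omega> * indicator (space P) \<omega> \<partial>P)"
    using nn_integral_Markov_inequality[of H "space P" P "ennreal (exp (- t))"]
    by (simp add: Int_def conj_commute)
  also have "(\<integral>\<^sup>+\<omega>. H \<omega> * indicator (space P) \<omega> \<partial>P) = (\<integral>\<^sup>+\<omega>. H \<omega> \<partial>P)"
    by (intro nn_integral_cong) simp
  also have "ennreal (exp (- t)) * \<dots> \<le> ennreal (exp (- t)) * 1"
    using EH by (rule mult_left_mono) simp
  finally have "measure P (space P - E) \<le> exp (- t)"
    by (simp add: P.emeasure_eq_measure)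
  then show "measure P {\<omega> \<in> space P. H \<omega> \<le> ennreal (exp t)} \<ge> 1 - exp (- t)"
    using P.prob_compl[OF E] by (simp add: E_def[symmetric])
qed

text \<open>What the exponential bound says about one direction \<open>v\<close>. The truncated sample forms are replaced
  by the original ones, which are larger, and $4 s^4$ collects $3 s^4$ from the Gaussian fourth
  moment and $s^4$ from the second moment of the trace.\<close>

lemma excess_consequence:
  assumes psd: "\<And>i. i \<in> I \<Longrightarrow> psd_matrix (X i \<omega>)" and I: "finite I"
    and X: "(\<integral>\<^sup>+x. ennreal (exp (excess \<eta> s S X I \<omega> (s *\<^sub>R x))) \<partial>std_gaussian) \<le> ennreal (exp t)"
    and \<eta>: "0 \<le> \<eta>" and S: "0 < S" and s: "0 < s" and v: "norm v = 1"
  shows "\<eta> * (card I * (v \<bullet> (expectation (\<lambda>\<omega>. soft_trunc S (M \<omega>)) *v v)) - (\<Sum>i\<in>I. v \<bullet> (X i \<omega> *v v)))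
    \<le> card I * (\<eta>\<^sup>2 * (\<kappa> ^ 4 * ((v \<bullet> (\<Sigma> *v v))\<^sup>2 + 6 * s\<^sup>2 * (v \<bullet> (\<Sigma> *v v)) * trace \<Sigma>
          + 4 * s ^ 4 * (trace \<Sigma>)\<^sup>2))) + t + 1 / (2 * s\<^sup>2)"
proof -
  interpret G: prob_space "std_gaussian :: (real ^ 'd) measure" by (rule prob_space_std_gaussian)
  have [simp]: "G.prob UNIV = 1" using G.prob_space by simp
  define B where "B = expectation (\<lambda>\<omega>. soft_trunc S (M \<omega>))"
  define c where "c = s ^ 4 * (trace \<Sigma>)\<^sup>2"
  define V where "V = (\<integral>x. ((v + s *\<^sub>R x) \<bullet> (\<Sigma> *v (v + s *\<^sub>R x)))\<^sup>2 \<partial>std_gaussian)"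
  have 1: "has_bochner_integral std_gaussian (\<lambda>x. ((v + s *\<^sub>R x) \<bullet> (\<Sigma> *v (v + s *\<^sub>R x)))\<^sup>2) V"
    using std_gaussian_shifted_quadratic_form_squared(1)[OF psd_mean, of v s]
    by (simp add: has_bochner_integral_iff V_def)
  have 2: "has_bochner_integral std_gaussian (\<lambda>x::real ^ 'd. c) c"
    by (simp add: has_bochner_integral_iff)
  have hb: "has_bochner_integral std_gaussian (\<lambda>x. excess \<eta> s S X I \<omega> (v + s *\<^sub>R x))
     (\<Sum>i\<in>I. \<eta> * (- (v \<bullet> (soft_trunc S (X i \<omega>) *v v)))
        - (\<eta> * (- (v \<bullet> (B *v v))) + \<eta>\<^sup>2 * (\<kappa> ^ 4 * (c + V))))"
    unfolding excess_def log_mgf_bound_def B_def[symmetric] c_def[symmetric]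
    by (intro has_bochner_integral_sum has_bochner_integral_diff has_bochner_integral_add
        has_bochner_integral_mult_right std_gaussian_compensated_form 1 2)
  have "(\<Sum>i\<in>I. \<eta> * (- (v \<bullet> (soft_trunc S (X i \<omega>) *v v)))
        - (\<eta> * (- (v \<bullet> (B *v v))) + \<eta>\<^sup>2 * (\<kappa> ^ 4 * (c + V)))) \<le> t + (norm v)\<^sup>2 / (2 * s\<^sup>2)"
  proof -
    have "excess \<eta> s S X I \<omega> \<in> borel_measurable borel"
      unfolding excess_def[abs_def] by measurable
    from gaussian_smoothing_bound[OF this s _ X, of v] hb
    show ?thesis by (simp add: has_bochner_integral_iff)
  qed
  then have "\<eta> * (card I * (v \<bullet> (B *v v)) - (\<Sum>i\<in>I. v \<bullet> (soft_trunc S (X i \<omega>) *v v)))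
      \<le> card I * (\<eta>\<^sup>2 * (\<kappa> ^ 4 * (c + V))) + t + 1 / (2 * s\<^sup>2)"
    using v by (simp add: sum_subtractf sum_negf sum.distrib sum_distrib_left algebra_simps)
  moreover have "(\<Sum>i\<in>I. v \<bullet> (soft_trunc S (X i \<omega>) *v v)) \<le> (\<Sum>i\<in>I. v \<bullet> (X i \<omega> *v v))"
    by (intro sum_mono soft_trunc_quadratic_form_le psd S)
  then have "\<eta> * (card I * (v \<bullet> (B *v v)) - (\<Sum>i\<in>I. v \<bullet> (X i \<omega> *v v)))
     \<le> \<eta> * (card I * (v \<bullet> (B *v v)) - (\<Sum>i\<in>I. v \<bullet> (soft_trunc S (X i \<omega>) *v v)))"
    using \<eta> by (intro mult_left_mono) auto
  moreover have "c + V \<le> (v \<bullet> (\<Sigma> *v v))\<^sup>2 + 6 * s\<^sup>2 * (v \<bullet> (\<Sigma> *v v)) * trace \<Sigma>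
          + 4 * s ^ 4 * (trace \<Sigma>)\<^sup>2"
    using std_gaussian_shifted_quadratic_form_squared(2)[OF psd_mean, of v s]
    by (simp add: c_def V_def)
  then have "card I * (\<eta>\<^sup>2 * (\<kappa> ^ 4 * (c + V))) \<le> card I * (\<eta>\<^sup>2 * (\<kappa> ^ 4 *
     ((v \<bullet> (\<Sigma> *v v))\<^sup>2 + 6 * s\<^sup>2 * (v \<bullet> (\<Sigma> *v v)) * trace \<Sigma> + 4 * s ^ 4 * (trace \<Sigma>)\<^sup>2)))"
    by (intro mult_left_mono) auto
  ultimately show ?thesis unfolding B_def by linarith
qed

end

section \<open>The lower tail bound\<close>

theorem proposition4:
  fixes Q :: "'b measure" and P :: "'a measure"
    and M :: "'b \<Rightarrow> real ^ 'd ^ 'd"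
    and X :: "nat \<Rightarrow> 'a \<Rightarrow> real ^ 'd ^ 'd"
    and \<Sigma> :: "real ^ 'd ^ 'd"
    and n :: nat and \<kappa> t :: real
  assumes "prob_space Q" and "prob_space P"
    and "M \<in> borel_measurable Q"
    and "AE \<omega> in Q. psd_matrix (M \<omega>)"
    and "integrable Q M" and "integral\<^sup>L Q M = \<Sigma>" and "\<Sigma> \<noteq> 0"
    and "n \<ge> 1"
    and "prob_space.indep_vars P (\<lambda>_. borel) X {1..n}"
    and "\<And>i. i \<in> {1..n} \<Longrightarrow> distr P borel (X i) = distr Q borel M"
    and "\<kappa> \<ge> 1"
    and "\<And>x :: real ^ 'd. integrable Q (\<lambda>\<omega>. (x \<bullet> (M \<omega> *v x))\<^sup>2)"
    and "\<And>x :: real ^ 'd.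
           sqrt (integral\<^sup>L Q (\<lambda>\<omega>. (x \<bullet> (M \<omega> *v x))\<^sup>2)) \<le> \<kappa>\<^sup>2 * (x \<bullet> (\<Sigma> *v x))"
    and "t > ln 2"
  shows "measure P {\<omega> \<in> space P.
           (SUP v \<in> sphere (0 :: real ^ 'd) 1.
              v \<bullet> (\<Sigma> *v v) - 1 / real n * (\<Sum>i = 1..n. v \<bullet> (X i \<omega> *v v)))
           \<le> 7 * \<kappa>\<^sup>2 * op_norm \<Sigma> * sqrt ((effective_rank \<Sigma> + t) / real n)}
         \<ge> 1 - 2 * exp (- t)"
proof -
  interpret psd_random_matrix Q M \<Sigma> \<kappa>
    by (intro psd_random_matrix.intro psd_random_matrix_axioms.intro assms)
  interpret P: prob_space P by fact
  define N where "N = op_norm \<Sigma>"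
  define T where "T = trace \<Sigma>"
  define \<epsilon> where "\<epsilon> = sqrt ((effective_rank \<Sigma> + t) / real n)"
  \<comment> \<open>$1/(2s^2)$ is the effective rank; with \<open>\<eta>\<close> of order \<open>\<epsilon>\<close> both terms of the smoothing bound are,
    after division by $n \eta$, of order \<open>\<epsilon>\<close>; \<open>S\<close>
    makes the truncation bias of that order too, while $\eta s^2 S = 1/4$\<close>
  define s where "s = sqrt (N / (2 * T))"
  define \<eta> where "\<eta> = \<epsilon> / (2 * \<kappa>\<^sup>2 * N)"
  define S where "S = \<kappa>\<^sup>2 * T / \<epsilon>"
  define c where "c = 7 * \<kappa>\<^sup>2 * N * \<epsilon>"
  have N: "0 < N" unfolding N_def by (rule op_norm_pos[OF \<open>\<Sigma> \<noteq> 0\<close>])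
  have T: "0 < T" unfolding T_def by (rule psd_matrix_trace_pos[OF psd_mean \<open>\<Sigma> \<noteq> 0\<close>])
  have n: "0 < real n" using \<open>n \<ge> 1\<close> by simp
  have \<kappa>: "0 < \<kappa>" using \<open>\<kappa> \<ge> 1\<close> by simp
  have t: "0 < t" using \<open>t > ln 2\<close> ln_gt_zero[of "2::real"] by linarith
  have er: "effective_rank \<Sigma> = T / N" by (simp add: effective_rank_def T_def N_def)
  have \<epsilon>: "0 < \<epsilon>" unfolding \<epsilon>_def er using N T t n by (simp add: add_pos_pos)
  have \<epsilon>2: "T / N + t = real n * \<epsilon>\<^sup>2"
    unfolding \<epsilon>_def er using N T t n by simp
  have \<eta>: "0 < \<eta>" unfolding \<eta>_def using \<epsilon> \<kappa> N by simp
  have S: "0 < S" unfolding S_def using \<epsilon> \<kappa> T by simp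
  have s: "0 < s" "s\<^sup>2 = N / (2 * T)" unfolding s_def using N T by simp_all
  have bd: "\<eta> * (s\<^sup>2 * S) \<le> 1"
    unfolding \<eta>_def S_def s(2) using N T \<kappa> \<epsilon> by (simp add: field_simps)
  define H where "H \<omega> = (\<integral>\<^sup>+x. ennreal (exp (excess \<eta> s S X {1..n} \<omega> (s *\<^sub>R x))) \<partial>std_gaussian)" for \<omega>
  note ev = smoothed_exponential_bound[OF \<open>prob_space P\<close> finite_atLeastAtMost assms(9,10) less_imp_le[OF \<eta>] S bd,
      folded H_def]
  \<comment> \<open>the event depends on the sample only through the empirical mean \<open>A\<close>, and on \<open>A\<close> through a
    closed condition; this gives its measurability\<close>
  define good where "good A \<longleftrightarrow> (\<forall>v\<in>sphere 0 1. v \<bullet> (\<Sigma> *v v) - v \<bullet> (A *v v) \<le> c)" for A :: "real ^ 'd ^ 'd"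
  have main: "good ((1 / real n) *\<^sub>R (\<Sum>i = 1..n. X i \<omega>))"
    if H: "H \<omega> \<le> ennreal (exp t)" and psd: "\<And>i. i \<in> {1..n} \<Longrightarrow> psd_matrix (X i \<omega>)" for \<omega>
    unfolding good_def
  proof
    fix v :: "real ^ 'd" assume "v \<in> sphere 0 1"
    then have v: "norm v = 1" by simp
    define q where "q = v \<bullet> (\<Sigma> *v v)"
    define b where "b = v \<bullet> (expectation (\<lambda>\<omega>. soft_trunc S (M \<omega>)) *v v)"
    define m where "m = (\<Sum>i = 1..n. v \<bullet> (X i \<omega> *v v))"
    have q: "0 \<le> q" "q \<le> N"
      unfolding q_def N_def by (rule psd_matrix_nonneg[OF psd_mean], rule quadratic_form_le_op_norm[OF v])
    have "\<eta> * (real n * b - m) \<le> real n * (\<eta>\<^sup>2 * (\<kappa> ^ 4 * (q\<^sup>2 + 6 * s\<^sup>2 * q * T + 4 * s ^ 4 * T\<^sup>2))) + t + 1 / (2 * s\<^sup>2)"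
      using excess_consequence[OF psd finite_atLeastAtMost H[unfolded H_def] less_imp_le[OF \<eta>] S s(1) v]
      by (simp add: q_def b_def m_def T_def)
    also have "q\<^sup>2 + 6 * s\<^sup>2 * q * T + 4 * s ^ 4 * T\<^sup>2 \<le> 5 * N\<^sup>2"
    proof -
      have "6 * s\<^sup>2 * q * T = 3 * (q * N)" unfolding s(2) using T by (simp add: field_simps)
      moreover have "4 * s ^ 4 * T\<^sup>2 = N\<^sup>2"
      proof -
        have "s ^ 4 = (s\<^sup>2)\<^sup>2" by simp
        then show ?thesis unfolding s(2) using T by (simp add: power_divide power_mult_distrib)
      qed
      moreover have "q\<^sup>2 \<le> N\<^sup>2" using q by (intro power_mono)
      moreover have "q * N \<le> N\<^sup>2" using q N unfolding power2_eq_square by (intro mult_right_mono) auto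
      ultimately show ?thesis by linarith
    qed
    then have "real n * (\<eta>\<^sup>2 * (\<kappa> ^ 4 * (q\<^sup>2 + 6 * s\<^sup>2 * q * T + 4 * s ^ 4 * T\<^sup>2)))
        \<le> real n * (\<eta>\<^sup>2 * (\<kappa> ^ 4 * (5 * N\<^sup>2)))"
      by (intro mult_left_mono) auto
    also have "\<dots> = real n * (5 / 4 * \<epsilon>\<^sup>2)"
      unfolding \<eta>_def using N \<kappa> by (simp add: field_simps power2_eq_square power4_eq_xxxx)
    finally have "\<eta> * (real n * b - m) \<le> real n * (5 / 4 * \<epsilon>\<^sup>2) + (t + 1 / (2 * s\<^sup>2))" by simp
    also have "t + 1 / (2 * s\<^sup>2) = real n * \<epsilon>\<^sup>2"
      unfolding s(2) using \<epsilon>2 N T by (simp add: field_simps)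
    finally have "\<eta> * (real n * b - m) \<le> real n * (9 / 4 * \<epsilon>\<^sup>2)" by simp
    then have "\<eta> * (b - 1 / real n * m) \<le> 9 / 4 * \<epsilon>\<^sup>2"
      using n by (simp add: field_simps)
    also have "\<dots> = \<eta> * (9 / 2 * \<kappa>\<^sup>2 * N * \<epsilon>)"
      unfolding \<eta>_def using N \<kappa> by (simp add: field_simps power2_eq_square)
    finally have 1: "b - 1 / real n * m \<le> 9 / 2 * \<kappa>\<^sup>2 * N * \<epsilon>"
      using \<eta> by simp
    have "q - b \<le> \<kappa> ^ 4 * (q * T) / S"
      using truncation_bias[OF S, of v] by (simp add: q_def b_def T_def)
    also have "\<dots> = \<kappa>\<^sup>2 * q * \<epsilon>"
      unfolding S_def using T \<kappa> \<epsilon> by (simp add: field_simps power2_eq_square power4_eq_xxxx)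
    also have "\<dots> \<le> \<kappa>\<^sup>2 * N * \<epsilon>"
      using q \<epsilon> by (intro mult_right_mono mult_left_mono) auto
    finally have 2: "q - b \<le> \<kappa>\<^sup>2 * N * \<epsilon>" .
    have "0 \<le> \<kappa>\<^sup>2 * N * \<epsilon>" using N \<epsilon> by simp
    then have "q - 1 / real n * m \<le> c" unfolding c_def using 1 2 by linarith
    then show "v \<bullet> (\<Sigma> *v v) - v \<bullet> (((1 / real n) *\<^sub>R (\<Sum>i = 1..n. X i \<omega>)) *v v) \<le> c"
      by (simp add: q_def m_def scaleR_matrix_vector_assoc[symmetric]
          linear_sum[OF bounded_linear.linear[OF bounded_linear_bilinear_form]])
  qed
  have SUP: "(SUP v \<in> sphere (0 :: real ^ 'd) 1.
              v \<bullet> (\<Sigma> *v v) - 1 / real n * (\<Sum>i = 1..n. v \<bullet> (X i \<omega> *v v))) \<le> c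
     \<longleftrightarrow> good ((1 / real n) *\<^sub>R (\<Sum>i = 1..n. X i \<omega>))" for \<omega>
  proof -
    define A where "A = (1 / real n) *\<^sub>R (\<Sum>i = 1..n. X i \<omega>)"
    have A: "v \<bullet> (\<Sigma> *v v) - 1 / real n * (\<Sum>i = 1..n. v \<bullet> (X i \<omega> *v v)) = v \<bullet> (\<Sigma> *v v) - v \<bullet> (A *v v)" for v
      by (simp add: A_def scaleR_matrix_vector_assoc[symmetric]
          linear_sum[OF bounded_linear.linear[OF bounded_linear_bilinear_form]])
    \<comment> \<open>boundedness is needed for the supremum to be characterised by its upper bounds\<close>
    have "compact ((\<lambda>v. v \<bullet> (\<Sigma> *v v) - v \<bullet> (A *v v)) ` sphere 0 1)"
      by (intro compact_continuous_image continuous_intros) auto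
    then have "bdd_above ((\<lambda>v. v \<bullet> (\<Sigma> *v v) - v \<bullet> (A *v v)) ` sphere 0 1)"
      by (intro bounded_imp_bdd_above compact_imp_bounded)
    then show ?thesis
      unfolding A good_def A_def[symmetric] by (subst cSUP_le_iff) auto
  qed
  have "closed {A. good A}"
  proof -
    have "{A. good A} = (\<Inter>v\<in>sphere 0 1. {A. v \<bullet> (\<Sigma> *v v) - v \<bullet> (A *v v) \<le> c})"
      by (auto simp: good_def)
    moreover have "closed {A. v \<bullet> (\<Sigma> *v v) - v \<bullet> (A *v v) \<le> c}" for v
      by (intro closed_Collect_le continuous_intros linear_continuous_on bounded_linear_bilinear_form)
    ultimately show ?thesis by auto
  qed
  then have [measurable]: "Measurable.pred borel good"
    by (simp add: pred_def borel_closed)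
  have X [measurable]: "X i \<in> borel_measurable P" if "i \<in> {1..n}" for i
    using assms(9) that by (auto simp: P.indep_vars_def)
  have psdX: "AE \<omega> in P. \<forall>i\<in>{1..n}. psd_matrix (X i \<omega>)"
  proof (rule AE_finite_allI)
    fix i assume i: "i \<in> {1..n}"
    have "AE A in distr Q borel M. psd_matrix A"
      using assms(4) by (subst AE_distr_iff) auto
    then have "AE A in distr P borel (X i). psd_matrix A" unfolding assms(10)[OF i] .
    then show "AE \<omega> in P. psd_matrix (X i \<omega>)"
      using X[OF i] by (subst (asm) AE_distr_iff) auto
  qed simp
  have "1 - 2 * exp (- t) \<le> 1 - exp (- t)" by simp
  also have "\<dots> \<le> measure P {\<omega> \<in> space P. H \<omega> \<le> ennreal (exp t)}" by (rule ev(2))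
  also have "\<dots> \<le> measure P {\<omega> \<in> space P. good ((1 / real n) *\<^sub>R (\<Sum>i = 1..n. X i \<omega>))}"
  proof (rule P.finite_measure_mono_AE)
    show "AE \<omega> in P. \<omega> \<in> {\<omega> \<in> space P. H \<omega> \<le> ennreal (exp t)} \<longrightarrow>
        \<omega> \<in> {\<omega> \<in> space P. good ((1 / real n) *\<^sub>R (\<Sum>i = 1..n. X i \<omega>))}"
      using psdX by (rule eventually_mono) (auto intro!: main simp del: One_nat_def)
  qed measurable
  finally show ?thesis
    unfolding SUP[symmetric] c_def N_def \<epsilon>_def .
qed

end
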